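(* Let $G=\bigcup_{i\ge1}G_i$ be the direct limit of the groups $G_1\le G_2\le\cdots$ of the construction described in the context (for any sequence of primes with $p_{i+1}\ne p_i$ and any choices of the extra-special groups $M_i$). Then $G$ is periodic, locally soluble, residually finite, and hereditarily just infinite (i.e. $G$ is infinite and every subgroup of finite index in $G$ is just infinite).
   Context: An infinite group is just infinite if every proper quotient of it is finite. For a group $X$ acted on by $Y$, $[X,Y]$ is generated by all $x^{-1}x^{y}$. A finite $p$-group $P$ is extra-special if $P'=Z(P)$ has order $p$. Construction: let $p_1,p_2,\dots$ be an infinite sequence of primes with $p_{i+1}\ne p_i$ for all $i$. Define finite groups $G_1\le G_2\le\cdots$ and subgroups $R_i\le G_i$ recursively. Let $G_1=R_1$ be cyclic of order $p_1$. For $i\ge2$: let $M_i$ be an extra-special group of order $p_i^3$; let $B$ be the base group of the regular wreath product $M_i\wr G_{i-1}$ (direct product of $|G_{i-1}|$ copies of $M_i$, permuted regularly by $G_{i-1}$); let $B_i=B/[B',G_{i-1}]$ with the induced $G_{i-1}$-action; $D_i=[B_i,R_{i-1}]$; $G_i=D_i\rtimes G_{i-1}$; $R_i=D_i'$. *)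

theory Defs
  imports "HOL-Algebra.Algebra" "HOL-Computational_Algebra.Primes"
begin

definition grp_center :: "('a, 'b) monoid_scheme \<Rightarrow> 'a set" where
  "grp_center P = {z \<in> carrier P. \<forall>x \<in> carrier P. z \<otimes>\<^bsub>P\<^esub> x = x \<otimes>\<^bsub>P\<^esub> z}"

definition extraspecial :: "('a, 'b) monoid_scheme \<Rightarrow> nat \<Rightarrow> bool" where
  "extraspecial P p \<longleftrightarrow> group P \<and> Factorial_Ring.prime p \<and> finite (carrier P) \<and>
     (\<exists>n. card (carrier P) = p ^ n) \<and>
     derived P (carrier P) = grp_center P \<and> card (grp_center P) = p"

definition periodic_group :: "('a, 'b) monoid_scheme \<Rightarrow> bool" where
  "periodic_group G \<longleftrightarrow> (\<forall>x \<in> carrier G. \<exists>n::nat. n > 0 \<and> x [^]\<^bsub>G\<^esub> n = \<one>\<^bsub>G\<^esub>)"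

definition locally_soluble :: "('a, 'b) monoid_scheme \<Rightarrow> bool" where
  "locally_soluble G \<longleftrightarrow>
     (\<forall>S. finite S \<and> S \<subseteq> carrier G \<longrightarrow> solvable (G\<lparr>carrier := generate G S\<rparr>))"

definition residually_finite :: "('a, 'b) monoid_scheme \<Rightarrow> bool" where
  "residually_finite G \<longleftrightarrow>
     (\<forall>x \<in> carrier G. x \<noteq> \<one>\<^bsub>G\<^esub> \<longrightarrow>
        (\<exists>N. N \<lhd> G \<and> finite (rcosets\<^bsub>G\<^esub> N) \<and> x \<notin> N))"

definition just_infinite :: "('a, 'b) monoid_scheme \<Rightarrow> bool" where
  "just_infinite G \<longleftrightarrow> group G \<and> infinite (carrier G) \<and>
     (\<forall>N. N \<lhd> G \<and> N \<noteq> {\<one>\<^bsub>G\<^esub>} \<longrightarrow> finite (carrier (G Mod N)))"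

definition hereditarily_just_infinite :: "('a, 'b) monoid_scheme \<Rightarrow> bool" where
  "hereditarily_just_infinite G \<longleftrightarrow> infinite (carrier G) \<and>
     (\<forall>H. subgroup H G \<and> finite (rcosets\<^bsub>G\<^esub> H) \<longrightarrow> just_infinite (G\<lparr>carrier := H\<rparr>))"

definition wr_base :: "('m, 'c) monoid_scheme \<Rightarrow> 'a set \<Rightarrow> ('a \<Rightarrow> 'm) monoid" where
  "wr_base M H = product_group H (\<lambda>_. M)"

definition reg_act :: "('a, 'b) monoid_scheme \<Rightarrow> 'a set \<Rightarrow> 'a \<Rightarrow> ('a \<Rightarrow> 'm) \<Rightarrow> ('a \<Rightarrow> 'm)" where
  "reg_act G H g f = (\<lambda>x\<in>H. f (x \<otimes>\<^bsub>G\<^esub> inv\<^bsub>G\<^esub> g))"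

definition coset_act :: "('a, 'b) monoid_scheme \<Rightarrow> 'a set \<Rightarrow> 'a \<Rightarrow> ('a \<Rightarrow> 'm) set \<Rightarrow> ('a \<Rightarrow> 'm) set" where
  "coset_act G H g C = reg_act G H g ` C"

definition act_comm :: "('c, 'd) monoid_scheme \<Rightarrow> 'c set \<Rightarrow> 'e set \<Rightarrow> ('e \<Rightarrow> 'c \<Rightarrow> 'c) \<Rightarrow> 'c set" where
  "act_comm K Xs Ys actf = generate K ((\<lambda>(a, b). inv\<^bsub>K\<^esub> a \<otimes>\<^bsub>K\<^esub> actf b a) ` (Xs \<times> Ys))"

definition quot_base :: "('a, 'b) monoid_scheme \<Rightarrow> 'a set \<Rightarrow> ('m, 'c) monoid_scheme \<Rightarrow> ('a \<Rightarrow> 'm) set monoid" where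
  "quot_base G H M =
     (let B = wr_base M H in B Mod act_comm B (derived B (carrier B)) H (reg_act G H))"

definition D_sub :: "('a, 'b) monoid_scheme \<Rightarrow> 'a set \<Rightarrow> 'a set \<Rightarrow> ('m, 'c) monoid_scheme \<Rightarrow> ('a \<Rightarrow> 'm) set set" where
  "D_sub G H R M =
     act_comm (quot_base G H M) (carrier (quot_base G H M)) R (coset_act G H)"

text \<open>
  The direct limit G = \<Union> G_i of the construction, realised inside an ambient group G:
  Gs i, Ds i, Rs i are the (images of the) groups G_(i+1), D_(i+1), R_(i+1) of the paper
  (0-based indexing), p i is the prime p_(i+1), M i is the group M_(i+1).
  Each step says: G_(i+1) is the internal semidirect product of Ds (i+1) by Gs i, where
  Ds (i+1) is isomorphic, compatibly with the action of Gs i (conjugation in G vs. the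
  induced regular action), to D = [B/[B',Gs i], Rs i].
\<close>
definition construction_limit ::
  "('a, 'b) monoid_scheme \<Rightarrow> (nat \<Rightarrow> nat) \<Rightarrow> (nat \<Rightarrow> ('m, 'c) monoid_scheme) \<Rightarrow>
   (nat \<Rightarrow> 'a set) \<Rightarrow> (nat \<Rightarrow> 'a set) \<Rightarrow> (nat \<Rightarrow> 'a set) \<Rightarrow> bool" where
  "construction_limit G p M Gs Ds Rs \<longleftrightarrow>
     group G \<and>
     (\<forall>i. Factorial_Ring.prime (p i)) \<and> (\<forall>i. p (Suc i) \<noteq> p i) \<and>
     (\<forall>i. extraspecial (M (Suc i)) (p (Suc i)) \<and> card (carrier (M (Suc i))) = p (Suc i) ^ 3) \<and>
     subgroup (Gs 0) G \<and> cyclic_group (G\<lparr>carrier := Gs 0\<rparr>) \<and> card (Gs 0) = p 0 \<and>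
     Rs 0 = Gs 0 \<and>
     (\<forall>i. Gs (Suc i) = Ds (Suc i) <#>\<^bsub>G\<^esub> Gs i \<and>
          Ds (Suc i) \<inter> Gs i = {\<one>\<^bsub>G\<^esub>} \<and>
          (\<exists>\<theta>. \<theta> \<in> iso ((quot_base G (Gs i) (M (Suc i)))\<lparr>carrier := D_sub G (Gs i) (Rs i) (M (Suc i))\<rparr>)
                         (G\<lparr>carrier := Ds (Suc i)\<rparr>) \<and>
               (\<forall>d \<in> D_sub G (Gs i) (Rs i) (M (Suc i)). \<forall>g \<in> Gs i.
                   \<theta> (coset_act G (Gs i) g d) = inv\<^bsub>G\<^esub> g \<otimes>\<^bsub>G\<^esub> \<theta> d \<otimes>\<^bsub>G\<^esub> g)) \<and>
          Rs (Suc i) = derived G (Ds (Suc i))) \<and>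
     (\<Union>i. Gs i) = carrier G"

end

theory Submission
  imports Defs
begin

text \<open>Write \<open>H = G\<^sub>i\<close>, \<open>R = R\<^sub>i\<close> of prime order \<open>q\<close>, \<open>D = D\<^sub>i\<^sub>+\<^sub>1\<close>. The commutator pairing of the class-two
  group \<open>B/[B', H]\<close> is \<open>(f, g) \<mapsto> \<Prod>x. [f x, g x]\<close>, with values in the centre of \<open>M\<close>, so a group ring
  computation shows that for every \<open>x \<noteq> 1\<close> in \<open>H\<close> some element of \<open>[D, x]\<close> is not central in \<open>D\<close>;
  hence \<open>D'\<close> has order \<open>p\<close> and is central, and \<open>D = [D, R]\<close> by coprime action.

  Let \<open>N \<noteq> 1\<close> be a subgroup of \<open>G\<close> normalised by almost all \<open>D\<^sub>m\<close>. For \<open>1 \<noteq> x \<in> N \<inter> G\<^sub>i\<close> with \<open>i\<close> large, \<open>N\<close>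
  contains \<open>[[D\<^sub>i\<^sub>+\<^sub>1, x], D\<^sub>i\<^sub>+\<^sub>1] \<noteq> 1\<close>, hence \<open>R\<^sub>i\<^sub>+\<^sub>1\<close>, hence \<open>D\<^sub>i\<^sub>+\<^sub>2 = [D\<^sub>i\<^sub>+\<^sub>2, R\<^sub>i\<^sub>+\<^sub>1]\<close>, and so on; thus \<open>N\<close> contains
  almost all \<open>D\<^sub>m\<close> and has finite index. Applied to the core of a subgroup of finite index, this shows
  that the latter contains almost all \<open>D\<^sub>m\<close>; applied again, that it is just infinite. The subgroups
  generated by the \<open>D\<^sub>m\<close> with \<open>m > n\<close> are normal complements to the \<open>G\<^sub>n\<close>, whence residual finiteness.\<close>

section \<open>Subgroups normalised by a subgroup\<close>

context group
begin

lemma inv_mult_cancel: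
  assumes "x \<in> carrier G" "y \<in> carrier G"
  shows "inv x \<otimes> (x \<otimes> y) = y" "x \<otimes> (inv x \<otimes> y) = y"
  using assms by (simp_all add: m_assoc[symmetric])

text \<open>A relation between two subsets instead of normality in a subgroup: \<open>N\<close> need
  not lie in \<open>H\<close>, nor contain it, when \<open>H\<close> acts on \<open>N\<close> by
  conjugation.\<close>

definition normalised_by :: "'a set \<Rightarrow> 'a set \<Rightarrow> bool" where
  "normalised_by N H \<longleftrightarrow> (\<forall>x\<in>N. \<forall>g\<in>H. inv g \<otimes> x \<otimes> g \<in> N)"

lemma normalised_byD: "normalised_by N H \<Longrightarrow> x \<in> N \<Longrightarrow> g \<in> H \<Longrightarrow> inv g \<otimes> x \<otimes> g \<in> N"
  by (simp add: normalised_by_def)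

lemma normalised_byD':
  assumes "normalised_by N H" "subgroup H G" "x \<in> N" "g \<in> H"
  shows "g \<otimes> x \<otimes> inv g \<in> N"
  using normalised_byD[OF assms(1,3) subgroup.m_inv_closed[OF assms(2,4)]] subgroup.mem_carrier[OF assms(2,4)]
  by simp

lemma normalised_by_mono: "normalised_by N H \<Longrightarrow> K \<subseteq> H \<Longrightarrow> normalised_by N K"
  by (auto simp: normalised_by_def)

lemma normalised_by_self: "subgroup N G \<Longrightarrow> normalised_by N N"
  by (simp add: normalised_by_def subgroup.m_closed subgroup.m_inv_closed)

text \<open>Conjugation by \<open>g\<close> is an endomorphism of the whole group, and homomorphisms
  carry derived subgroups to derived subgroups.\<close>

lemma normalised_by_derived:
  assumes "subgroup D G" "H \<subseteq> carrier G" "normalised_by D H"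
  shows "normalised_by (derived G D) H"
  unfolding normalised_by_def
proof (intro ballI)
  fix x g assume x: "x \<in> derived G D" and g: "g \<in> H"
  then have gc: "g \<in> carrier G" using assms by auto
  let ?c = "\<lambda>y. inv g \<otimes> y \<otimes> g"
  interpret c: group_hom G G ?c
    by unfold_locales (auto simp: hom_def gc m_assoc inv_mult_cancel)
  have "?c x \<in> ?c ` derived G D" using x by blast
  also have "\<dots> = derived G (?c ` D)"
    using c.derived_img[OF subgroup.subset[OF assms(1)]] by simp
  also have "\<dots> \<subseteq> derived G D"
    by (rule mono_derived) (use normalised_byD[OF assms(3)] g in auto)
  finally show "?c x \<in> derived G D" .
qed

lemma normalised_by_imp_normal:
  assumes "subgroup N G" "normalised_by N (carrier G)" shows "N \<lhd> G"
  using assms normalised_byD' subgroup_self by (intro normal_invI) auto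

lemma normal_imp_normalised_by: "N \<lhd> G\<lparr>carrier := H\<rparr> \<Longrightarrow> subgroup H G \<Longrightarrow> normalised_by N H"
  using normal.inv_op_closed1[of N "G\<lparr>carrier := H\<rparr>"] m_inv_consistent[of H]
  by (auto simp: normalised_by_def)

text \<open>With the next lemma this evaluates words modulo \<open>D\<close> through representatives
  in \<open>H\<close>. No quotient group is formed, as \<open>D\<close> is normalised by
  \<open>H\<close> but perhaps not by the whole group.\<close>

lemma rcoset_mult_normalised:
  assumes D: "subgroup D G" and H: "subgroup H G" and n: "normalised_by D H"
    and h: "h \<in> H" "k \<in> H" and xy: "x \<in> D #> h" "y \<in> D #> k"
  shows "x \<otimes> y \<in> D #> (h \<otimes> k)"
proof -
  obtain d e where *: "d \<in> D" "e \<in> D" "x = d \<otimes> h" "y = e \<otimes> k"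
    using xy by (auto simp: r_coset_def)
  have c: "d \<in> carrier G" "e \<in> carrier G" "h \<in> carrier G" "k \<in> carrier G"
    using * h D H by (auto dest: subgroup.mem_carrier)
  have "h \<otimes> e \<otimes> inv h \<in> D" using normalised_byD'[OF n H *(2) h(1)] .
  then have "d \<otimes> (h \<otimes> e \<otimes> inv h) \<in> D" using * D by (simp add: subgroup.m_closed)
  moreover have "x \<otimes> y = d \<otimes> (h \<otimes> e \<otimes> inv h) \<otimes> (h \<otimes> k)"
    using * c by (simp add: m_assoc inv_mult_cancel)
  ultimately show ?thesis by (auto simp: r_coset_def)
qed

lemma rcoset_inv_normalised:
  assumes D: "subgroup D G" and H: "subgroup H G" and n: "normalised_by D H"
    and h: "h \<in> H" and x: "x \<in> D #> h"
  shows "inv x \<in> D #> inv h"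
proof -
  obtain d where *: "d \<in> D" "x = d \<otimes> h" using x by (auto simp: r_coset_def)
  have c: "d \<in> carrier G" "h \<in> carrier G"
    using * h D H by (auto dest: subgroup.mem_carrier)
  have "inv h \<otimes> inv d \<otimes> h \<in> D"
    using normalised_byD[OF n _ h] * D by (simp add: subgroup.m_inv_closed)
  moreover have "inv x = (inv h \<otimes> inv d \<otimes> h) \<otimes> inv h"
    using * c by (simp add: m_assoc inv_mult_group)
  ultimately show ?thesis by (auto simp: r_coset_def)
qed

lemma set_mult_eq_rcosets: "D <#> H = (\<Union>h\<in>H. D #> h)"
  by (auto simp: set_mult_def r_coset_def)

lemma subgroup_set_mult_normalised:
  assumes D: "subgroup D G" and H: "subgroup H G" and n: "normalised_by D H"
  shows "subgroup (D <#> H) G"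
proof (rule subgroupI)
  show "D <#> H \<subseteq> carrier G"
    using D H by (intro set_mult_closed) (auto dest: subgroup.subset)
  show "D <#> H \<noteq> {}"
    using subgroup.one_closed[OF D] subgroup.one_closed[OF H] by (auto simp: set_mult_def)
next
  fix a assume "a \<in> D <#> H"
  then show "inv a \<in> D <#> H"
    using rcoset_inv_normalised[OF assms] subgroup.m_inv_closed[OF H]
    unfolding set_mult_eq_rcosets by blast
next
  fix a b assume "a \<in> D <#> H" "b \<in> D <#> H"
  then obtain h k where *: "h \<in> H" "k \<in> H" "a \<in> D #> h" "b \<in> D #> k"
    by (auto simp: set_mult_eq_rcosets)
  show "a \<otimes> b \<in> D <#> H"
    using rcoset_mult_normalised[OF assms *] subgroup.m_closed[OF H *(1,2)]
    unfolding set_mult_eq_rcosets by blast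
qed

lemma subset_set_mult:
  assumes "subgroup D G" "subgroup H G"
  shows "D \<subseteq> D <#> H" "H \<subseteq> D <#> H"
proof -
  show "D \<subseteq> D <#> H"
    using subgroup.one_closed[OF assms(2)] subgroup.mem_carrier[OF assms(1)] r_one
    unfolding set_mult_def by force
  show "H \<subseteq> D <#> H"
    using subgroup.one_closed[OF assms(1)] subgroup.mem_carrier[OF assms(2)] l_one
    unfolding set_mult_def by force
qed

text \<open>Modulo \<open>D\<close>, the commutator of elements of \<open>D #> h\<close> and
  \<open>D #> k\<close> is that of \<open>h\<close> and \<open>k\<close>.\<close>

lemma derived_set_mult:
  assumes D: "subgroup D G" and H: "subgroup H G" and n: "normalised_by D H"
  shows "derived G (D <#> H) \<subseteq> D <#> derived G H"
proof -
  have sub: "derived G H \<subseteq> H" by (rule derived_incl[OF _ H]) simp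
  have dH: "subgroup (derived G H) G" by (rule derived_is_subgroup[OF subgroup.subset[OF H]])
  have "subgroup (D <#> derived G H) G"
    by (rule subgroup_set_mult_normalised[OF D dH normalised_by_mono[OF n sub]])
  moreover have "derived_set G (D <#> H) \<subseteq> D <#> derived G H"
  proof clarify
    fix x y assume "x \<in> D <#> H" "y \<in> D <#> H"
    then obtain h k where *: "h \<in> H" "k \<in> H" "x \<in> D #> h" "y \<in> D #> k"
      by (auto simp: set_mult_eq_rcosets)
    note mi = subgroup.m_inv_closed[OF H] subgroup.m_closed[OF H]
      rcoset_mult_normalised[OF assms] rcoset_inv_normalised[OF assms]
    have "x \<otimes> y \<otimes> inv x \<otimes> inv y \<in> D #> (h \<otimes> k \<otimes> inv h \<otimes> inv k)"
      by (intro mi *)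
    moreover have "h \<otimes> k \<otimes> inv h \<otimes> inv k \<in> derived G H"
      unfolding derived_def using * by (intro generate.incl) blast
    ultimately show "x \<otimes> y \<otimes> inv x \<otimes> inv y \<in> D <#> derived G H"
      by (auto simp: set_mult_eq_rcosets)
  qed
  ultimately show ?thesis unfolding derived_def[of G "D <#> H"]
    by (rule generate_subgroup_incl[rotated])
qed

text \<open>Lagrange in \<open>R\<close>: the order of \<open>N \<inter> R\<close> divides a prime
  and is not 1.\<close>

lemma prime_card_subset:
  assumes R: "subgroup R G" "Factorial_Ring.prime (card R)" and N: "subgroup N G"
    and y: "y \<in> N" "y \<in> R" "y \<noteq> \<one>"
  shows "R \<subseteq> N"
proof -
  have fin: "finite R" using R(2) by (metis card.infinite not_prime_0)
  interpret Rg: group "G\<lparr>carrier := R\<rparr>" by (rule subgroup_imp_group[OF R(1)])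
  have "subgroup (N \<inter> R) (G\<lparr>carrier := R\<rparr>)"
    using subgroups_Inter_pair[OF N R(1)] R(1) by (rule subgroup_incl) simp
  from Rg.lagrange[OF this] have "card (N \<inter> R) dvd card R"
    unfolding order_def by (simp, metis dvd_triv_right)
  moreover have "card (N \<inter> R) \<noteq> 1"
  proof
    assume "card (N \<inter> R) = 1"
    then obtain z where "N \<inter> R = {z}" by (rule card_1_singletonE)
    then have "y = z" "\<one> = z"
      using y subgroup.one_closed[OF N] subgroup.one_closed[OF R(1)] by (metis IntI singletonD)+
    then show False using y(3) by simp
  qed
  ultimately have "card (N \<inter> R) = card R"
    using R(2) prime_nat_iff by blast
  then have "N \<inter> R = R" using fin by (intro card_subset_eq) auto
  then show ?thesis by blast
qed

text \<open>Derived series are computed throughout with the operator of the ambient group, so that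
  those of different subgroups can be compared.\<close>

lemma solvable_subgroupI:
  assumes K: "subgroup K G" and d: "(derived G ^^ n) K \<subseteq> {\<one>}"
  shows "solvable (G\<lparr>carrier := K\<rparr>)"
proof -
  interpret K: group "G\<lparr>carrier := K\<rparr>" by (rule subgroup_imp_group[OF K])
  have "(derived (G\<lparr>carrier := K\<rparr>) ^^ m) K = (derived G ^^ m) K \<and> (derived G ^^ m) K \<subseteq> K" for m
  proof (induction m)
    case (Suc m)
    then show ?case
      using derived_consistent[OF _ K] derived_incl[OF _ K] by auto
  qed simp
  moreover have "\<one> \<in> (derived G ^^ n) K"
    using exp_of_derived_is_subgroup[OF K] by (simp add: subgroup.one_closed)
  ultimately have "(derived (G\<lparr>carrier := K\<rparr>) ^^ n) K = {\<one>}" using d by auto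
  then show ?thesis
    unfolding K.solvable_iff_trivial_derived_seq by auto
qed

text \<open>\<open>N\<close> is the kernel of the action by right multiplication on the cosets of
  \<open>H\<close>; fixing the coset \<open>H\<close> itself forces
  \<open>N \<subseteq> H\<close>.\<close>

lemma finite_index_normal_core:
  assumes inf: "infinite (carrier G)" and H: "subgroup H G" and fin: "finite (rcosets H)"
  obtains N where "N \<lhd> G" "N \<subseteq> H" "N \<noteq> {\<one>}"
proof -
  define N where "N = {x \<in> carrier G. \<forall>C \<in> rcosets H. C #> x = C}"
  have cc: "C \<subseteq> carrier G" if "C \<in> rcosets H" for C
    using that H by (simp add: subgroup.rcosets_carrier[OF H is_group])
  have ccl: "C #> x \<in> rcosets H" if "C \<in> rcosets H" "x \<in> carrier G" for C x
    using that subgroup.subset[OF H] by (auto simp: RCOSETS_def coset_mult_assoc)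
  have Nx: "C #> x = C" if "x \<in> N" "C \<in> rcosets H" for x C
    using that by (auto simp: N_def)
  have sub: "subgroup N G"
  proof (rule subgroupI)
    show "N \<subseteq> carrier G" by (auto simp: N_def)
    have "\<one> \<in> N" using cc by (simp add: N_def)
    then show "N \<noteq> {}" by blast
  next
    fix a assume a: "a \<in> N"
    have "C #> inv a = C" if "C \<in> rcosets H" for C
      using a that cc[OF that] coset_mult_assoc[of C a "inv a"] by (auto simp: N_def)
    then show "inv a \<in> N" using a by (simp add: N_def)
  next
    fix a b assume "a \<in> N" "b \<in> N"
    then show "a \<otimes> b \<in> N" using cc by (simp add: N_def coset_mult_assoc[symmetric])
  qed
  have "normalised_by N (carrier G)"
    unfolding normalised_by_def
  proof (intro ballI)
    fix x g assume *: "x \<in> N" "g \<in> carrier G"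
    then have x: "x \<in> carrier G" by (simp add: N_def)
    have "C #> (inv g \<otimes> x \<otimes> g) = C" if C: "C \<in> rcosets H" for C
    proof -
      have "C #> (inv g \<otimes> x \<otimes> g) = (C #> inv g) #> x #> g"
        using cc[OF C] x * by (simp add: coset_mult_assoc m_assoc)
      also have "(C #> inv g) #> x = C #> inv g"
        using Nx[OF *(1) ccl[OF C]] * by simp
      also have "C #> inv g #> g = C"
        using cc[OF C] * by (simp add: coset_mult_assoc)
      finally show ?thesis .
    qed
    then show "inv g \<otimes> x \<otimes> g \<in> N" using x * by (simp add: N_def)
  qed
  with sub have 1: "N \<lhd> G" by (rule normalised_by_imp_normal)
  have Hin: "H \<in> rcosets H"
    using subgroup.subgroup_in_rcosets[OF H is_group] .
  have 2: "N \<subseteq> H"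
  proof
    fix x assume "x \<in> N"
    then have "H #> x = H" "x \<in> carrier G" using Nx[OF _ Hin] by (simp_all add: N_def)
    then show "x \<in> H" using coset_join1[OF _ _ H] by blast
  qed
  \<comment> \<open>Pigeonhole: an infinite group induces only finitely many maps on the finite set
    of cosets. If \<open>g\<close> and \<open>h\<close> induce the same map,
    \<open>h \<otimes> inv g\<close> fixes every coset.\<close>
  let ?f = "\<lambda>g. \<lambda>C\<in>rcosets H. C #> g"
  have "?f ` carrier G \<subseteq> (\<Pi>\<^sub>E C\<in>rcosets H. rcosets H)"
    using ccl by (auto simp: PiE_iff)
  then have "finite (?f ` carrier G)"
    by (rule finite_subset) (intro finite_PiE fin)
  then obtain g where g: "g \<in> carrier G" "infinite {h \<in> carrier G. ?f h = ?f g}"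
    using inf pigeonhole_infinite by blast
  then have "\<not> {h \<in> carrier G. ?f h = ?f g} \<subseteq> {g}"
    using finite_subset by blast
  then obtain h where h: "h \<in> carrier G" "?f h = ?f g" "h \<noteq> g" by blast
  have "C #> (h \<otimes> inv g) = C" if C: "C \<in> rcosets H" for C
  proof -
    have "C #> h = C #> g" using fun_cong[OF h(2), of C] C by simp
    then have "C #> h #> inv g = C #> g #> inv g" by simp
    then show ?thesis using cc[OF C] g h by (simp add: coset_mult_assoc)
  qed
  then have "h \<otimes> inv g \<in> N" using g h by (simp add: N_def)
  moreover have "h \<otimes> inv g \<noteq> \<one>"
    using g(1) h(1,3) inv_equality[of h "inv g"] by auto
  ultimately have 3: "N \<noteq> {\<one>}" by blast
  show thesis by (rule that[OF 1 2 3])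
qed

end

section \<open>Coprime action on a group of class two\<close>

text \<open>Isolates what the proof of D = [D, R] uses of B/[B', H]. \<open>G\<close> serves to
  carry the multiplication of \<open>R\<close>; \<open>act\<close> is a right action, hence the
  order of the factors in \<open>act_mult\<close>.\<close>

locale coprime_action = group Q + A: group G
  for Q :: "('q, 'r) monoid_scheme" (structure) and G :: "('a, 'b) monoid_scheme" +
  fixes R :: "'a set" and act :: "'a \<Rightarrow> 'q \<Rightarrow> 'q" and p q n :: nat and Z :: "'q set"
  assumes R: "subgroup R G" "card R = q" "Factorial_Ring.prime q"
    and p: "Factorial_Ring.prime p" "p \<noteq> q"
    and act_hom: "\<And>g. g \<in> R \<Longrightarrow> act g \<in> hom Q Q"
    and act_mult: "\<And>g h x. \<lbrakk>g \<in> R; h \<in> R; x \<in> carrier Q\<rbrakk> \<Longrightarrow> act (g \<otimes>\<^bsub>G\<^esub> h) x = act h (act g x)"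
    and act_one: "\<And>x. x \<in> carrier Q \<Longrightarrow> act \<one>\<^bsub>G\<^esub> x = x"
    and Z: "subgroup Z Q" "card Z = p"
    and Z_central: "\<And>z x. \<lbrakk>z \<in> Z; x \<in> carrier Q\<rbrakk> \<Longrightarrow> z \<otimes>\<^bsub>Q\<^esub> x = x \<otimes>\<^bsub>Q\<^esub> z"
    and comm_Z: "\<And>x y. \<lbrakk>x \<in> carrier Q; y \<in> carrier Q\<rbrakk> \<Longrightarrow> x \<otimes>\<^bsub>Q\<^esub> y \<otimes>\<^bsub>Q\<^esub> inv\<^bsub>Q\<^esub> x \<otimes>\<^bsub>Q\<^esub> inv\<^bsub>Q\<^esub> y \<in> Z"
    and exponent: "\<And>x. x \<in> carrier Q \<Longrightarrow> x [^]\<^bsub>Q\<^esub> (p ^ n) = \<one>\<^bsub>Q\<^esub>"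
begin

lemma act_closed [simp]: "g \<in> R \<Longrightarrow> x \<in> carrier Q \<Longrightarrow> act g x \<in> carrier Q"
  using act_hom by (auto simp: hom_def)

lemma act_dist [simp]:
  "g \<in> R \<Longrightarrow> x \<in> carrier Q \<Longrightarrow> y \<in> carrier Q \<Longrightarrow> act g (x \<otimes> y) = act g x \<otimes> act g y"
  using act_hom by (auto simp: hom_def)

definition "D = act_comm Q (carrier Q) R act"

lemma act_comm_subgroup:
  assumes "S \<subseteq> carrier Q" shows "subgroup (act_comm Q S R act) Q"
  unfolding act_comm_def using assms by (intro generate_is_subgroup) auto

lemma D_subgroup: "subgroup D Q"
  unfolding D_def by (rule act_comm_subgroup) simp

lemma D_carrier: "D \<subseteq> carrier Q"
  using D_subgroup by (rule subgroup.subset)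

lemma gen_in_act_comm:
  "x \<in> S \<Longrightarrow> g \<in> R \<Longrightarrow> inv x \<otimes> act g x \<in> act_comm Q S R act"
  unfolding act_comm_def by (rule generate.incl) force

lemma Z_normal: "Z \<lhd> Q"
proof (rule normal_invI[OF Z(1)])
  fix x h assume *: "x \<in> carrier Q" "h \<in> Z"
  then have "x \<otimes> h \<otimes> inv x = h \<otimes> x \<otimes> inv x"
    using Z_central[of h x] by simp
  also have "\<dots> = h" using * subgroup.mem_carrier[OF Z(1)] by (simp add: m_assoc)
  finally show "x \<otimes> h \<otimes> inv x \<in> Z" using * by simp
qed

abbreviation "DR \<equiv> act_comm Q D R act"

lemma DR_subgroup: "subgroup DR Q"
  using D_carrier by (rule act_comm_subgroup)

text \<open>Conjugation changes an element by a commutator, hence by a factor in \<open>Z\<close>;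
  so every subgroup containing \<open>Z\<close> is normal.\<close>

lemma ZDR_normal: "(Z <#> DR) \<lhd> Q"
proof (rule normal_invI)
  show sub: "subgroup (Z <#> DR) Q"
    by (rule mult_norm_subgroup[OF Z_normal DR_subgroup])
  have ZW: "Z \<subseteq> Z <#> DR"
    using subgroup.one_closed[OF DR_subgroup] subgroup.subset[OF Z(1)]
    by (force simp: set_mult_def)
  fix x h assume *: "x \<in> carrier Q" "h \<in> Z <#> DR"
  then have h: "h \<in> carrier Q" using subgroup.mem_carrier[OF sub] by simp
  have "x \<otimes> h \<otimes> inv x = (x \<otimes> h \<otimes> inv x \<otimes> inv h) \<otimes> h"
    using * h by (simp add: m_assoc)
  then show "x \<otimes> h \<otimes> inv x \<in> Z <#> DR"
    using subgroup.m_closed[OF sub, of "x \<otimes> h \<otimes> inv x \<otimes> inv h" h] comm_Z[of x h] ZW * h by auto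
qed

text \<open>Modulo the normal subgroup \<open>Z[D, R]\<close> the action of \<open>r\<close> fixes \<open>d = b\<^sup>-\<^sup>1 b\<^sup>r\<close>, so \<open>b\<^sup>-\<^sup>1 b^(r^k)\<close> is \<open>d^k\<close>.
  Taking \<open>k = q\<close> gives \<open>d^q = 1\<close>, and \<open>d\<close> also has \<open>p\<close>-power order.\<close>

lemma gen_in_ZDR:
  assumes b: "b \<in> carrier Q" and r: "r \<in> R"
  shows "inv b \<otimes> act r b \<in> Z <#> DR"
proof -
  interpret W: normal "Z <#> DR" Q by (rule ZDR_normal)
  let ?F = "Q Mod (Z <#> DR)"
  interpret F: group ?F by (rule W.factorgroup_is_group)
  let ?h = "\<lambda>x. (Z <#> DR) #> x"
  interpret h: group_hom Q ?F ?h
    by unfold_locales (rule W.r_coset_hom_Mod)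
  define d where "d = inv b \<otimes> act r b"
  have d: "d \<in> D" "d \<in> carrier Q"
    using gen_in_act_comm[of b "carrier Q" r] b r by (auto simp: D_def d_def)
  have DRW: "DR \<subseteq> Z <#> DR"
    using subgroup.one_closed[OF Z(1)] subgroup.subset[OF DR_subgroup]
    by (force simp: set_mult_def)
  have trivial: "?h x = \<one>\<^bsub>?F\<^esub> \<longleftrightarrow> x \<in> Z <#> DR" if "x \<in> carrier Q" for x
    using that by (metis W.subgroup_axioms coset_join1 coset_join2 one_FactGroup W.subset)
  have inv_d: "?h (act s d) = ?h d" if s: "s \<in> R" for s
  proof -
    have "inv d \<otimes> act s d \<in> Z <#> DR"
      using gen_in_act_comm[OF d(1) s] DRW by blast
    then have "?h (inv d \<otimes> act s d) = \<one>\<^bsub>?F\<^esub>"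
      using trivial[of "inv d \<otimes> act s d"] act_closed[OF s d(2)] d by blast
    then have "inv\<^bsub>?F\<^esub> ?h d \<otimes>\<^bsub>?F\<^esub> ?h (act s d) = \<one>\<^bsub>?F\<^esub>"
      using d s h.hom_mult h.hom_inv by (metis act_closed inv_closed)
    then show ?thesis
      using d s by (metis F.inv_equality F.inv_inv F.inv_closed act_closed h.hom_closed)
  qed
  have rk: "r [^]\<^bsub>G\<^esub> k \<in> R" for k :: nat
    using r R(1) by (induction k) (auto simp: subgroup.one_closed subgroup.m_closed)
  have "?h (inv b \<otimes> act (r [^]\<^bsub>G\<^esub> k) b) = ?h d [^]\<^bsub>?F\<^esub> k" for k :: nat
  proof (induction k)
    case 0
    have "?h (inv b \<otimes> act (r [^]\<^bsub>G\<^esub> (0::nat)) b) = ?h \<one>"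
      using b act_one by simp
    then show ?case by (simp only: h.hom_one F.nat_pow_0)
  next
    case (Suc k)
    have "act (r [^]\<^bsub>G\<^esub> Suc k) b = act (r [^]\<^bsub>G\<^esub> k) (act r b)"
      using A.nat_pow_Suc2[of r k] r R(1) act_mult[OF r rk b] subgroup.mem_carrier by metis
    also have "act r b = b \<otimes> d"
      using b r by (simp add: d_def m_assoc[symmetric])
    also have "act (r [^]\<^bsub>G\<^esub> k) (b \<otimes> d) = act (r [^]\<^bsub>G\<^esub> k) b \<otimes> act (r [^]\<^bsub>G\<^esub> k) d"
      using b d rk by simp
    finally have "inv b \<otimes> act (r [^]\<^bsub>G\<^esub> Suc k) b =
        (inv b \<otimes> act (r [^]\<^bsub>G\<^esub> k) b) \<otimes> act (r [^]\<^bsub>G\<^esub> k) d"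
      using b d rk[of k] by (simp add: m_assoc)
    then have "?h (inv b \<otimes> act (r [^]\<^bsub>G\<^esub> Suc k) b) =
        ?h (inv b \<otimes> act (r [^]\<^bsub>G\<^esub> k) b) \<otimes>\<^bsub>?F\<^esub> ?h (act (r [^]\<^bsub>G\<^esub> k) d)"
      using b d rk[of k] h.hom_mult by (metis act_closed inv_closed m_closed)
    then show ?case
      using Suc inv_d[OF rk[of k]] by simp
  qed
  from this[of q] have "?h (inv b \<otimes> act (r [^]\<^bsub>G\<^esub> q) b) = ?h d [^]\<^bsub>?F\<^esub> q" .
  moreover have "r [^]\<^bsub>G\<^esub> q = \<one>\<^bsub>G\<^esub>"
    using group.pow_order_eq_1[OF A.subgroup_imp_group[OF R(1)]] r R(2) 
    by (simp add: order_def nat_pow_def)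
  ultimately have "?h d [^]\<^bsub>?F\<^esub> q = ?h \<one>"
    using b act_one by simp
  then have 1: "?h d [^]\<^bsub>?F\<^esub> q = \<one>\<^bsub>?F\<^esub>"
    by (simp only: h.hom_one)
  have 2: "?h d [^]\<^bsub>?F\<^esub> (p ^ n) = \<one>\<^bsub>?F\<^esub>"
    using h.hom_nat_pow[of d "p ^ n"] d exponent h.hom_one by metis
  have hd: "?h d \<in> carrier ?F" using d h.hom_closed by blast
  have "coprime q (p ^ n)"
    using R(3) p primes_coprime by (metis coprime_power_right_iff)
  then have "F.ord (?h d) = 1"
    using 1 2 F.pow_eq_id[OF hd] coprime_common_divisor_nat by (metis One_nat_def coprime_def nat_dvd_1_iff_1)
  then have "?h d = \<one>\<^bsub>?F\<^esub>"
    using F.ord_eq_1[OF hd] by simp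
  then show ?thesis
    using trivial d by (simp add: d_def)
qed

lemma D_sub_ZDR: "D \<subseteq> Z <#> DR"
  unfolding D_def act_comm_def
proof (rule generate_subgroup_incl[OF _ normal_imp_subgroup[OF ZDR_normal[unfolded D_def act_comm_def]]], clarsimp)
  fix b r assume "b \<in> carrier Q" "r \<in> R"
  then show "inv b \<otimes> act r b
     \<in> Z <#> generate Q ((\<lambda>x. case x of (a, b) \<Rightarrow> inv a \<otimes> act b a) `
           (generate Q ((\<lambda>x. case x of (a, b) \<Rightarrow> inv a \<otimes> act b a) ` (carrier Q \<times> R)) \<times> R))"
    using gen_in_ZDR[of b r] by (simp add: D_def act_comm_def)
qed

lemma derived_D_in_Z: "derived Q D \<subseteq> Z"
  unfolding derived_def
  using D_carrier comm_Z by (intro generate_subgroup_incl[OF _ Z(1)]) blast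

text \<open>A non-commuting pair has a nontrivial commutator in \<open>Z\<close>, and this generates
  \<open>Z\<close> because the order is prime.\<close>

lemma derived_D:
  assumes de: "d \<in> D" "e \<in> D" "d \<otimes> e \<noteq> e \<otimes> d"
  shows "derived Q D = Z"
proof -
  have sub: "subgroup (derived Q D) Q"
    by (rule derived_is_subgroup[OF D_carrier])
  have c: "d \<in> carrier Q" "e \<in> carrier Q" using de D_carrier by auto
  let ?y = "d \<otimes> e \<otimes> inv d \<otimes> inv e"
  have y: "?y \<in> derived Q D"
    unfolding derived_def using de by (intro generate.incl) blast
  have "?y \<noteq> \<one>"
  proof
    assume "?y = \<one>"
    moreover have "d \<otimes> e = ?y \<otimes> (e \<otimes> d)"
      using c by (simp add: m_assoc inv_mult_cancel)
    ultimately show False using de(3) c by simp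
  qed
  then show ?thesis
    using prime_card_subset[OF Z(1) _ sub y _] y derived_D_in_Z Z(2) p(1) by blast
qed

text \<open>As \<open>Z\<close> is central, \<open>D = Z[D, R]\<close> forces \<open>Z = D' \<subseteq> [D, R]\<close>.\<close>

lemma D_subset_DR:
  assumes de: "d \<in> D" "e \<in> D" "d \<otimes> e \<noteq> e \<otimes> d"
  shows "D \<subseteq> DR"
proof -
  have "derived Q D \<subseteq> DR"
    unfolding derived_def
  proof (rule generate_subgroup_incl[OF _ DR_subgroup], clarify)
    fix x y assume "x \<in> D" "y \<in> D"
    then have "x \<in> Z <#> DR" "y \<in> Z <#> DR" using D_sub_ZDR by auto
    then obtain z k z' k' where *: "z \<in> Z" "k \<in> DR" "z' \<in> Z" "k' \<in> DR" "x = z \<otimes> k" "y = z' \<otimes> k'"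
      by (auto simp: set_mult_def)
    have c: "z \<in> carrier Q" "k \<in> carrier Q" "z' \<in> carrier Q" "k' \<in> carrier Q"
      using * subgroup.mem_carrier[OF Z(1)] subgroup.mem_carrier[OF DR_subgroup] by auto
    have iz: "inv z \<in> Z" "inv z' \<in> Z" using * Z(1) by (auto simp: subgroup.m_inv_closed)
    \<comment> \<open>The central factors \<open>z\<close> and \<open>z'\<close> cancel, so that
      [x, y] = [k, k'], a commutator of elements of \<open>DR\<close>. The chain below moves these
      factors together.\<close>
    have "x \<otimes> y \<otimes> inv x \<otimes> inv y = z \<otimes> (k \<otimes> z') \<otimes> k' \<otimes> inv k \<otimes> inv z \<otimes> inv k' \<otimes> inv z'"
      using c * by (simp add: m_assoc inv_mult_group)
    also have "\<dots> = z \<otimes> z' \<otimes> (k \<otimes> k' \<otimes> inv k \<otimes> (inv z \<otimes> inv k') \<otimes> inv z')"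
      by (subst Z_central[OF *(3) c(2), symmetric]) (simp add: m_assoc c)
    also have "\<dots> = z \<otimes> z' \<otimes> ((k \<otimes> k' \<otimes> inv k \<otimes> inv k') \<otimes> (inv z \<otimes> inv z'))"
      using c Z_central[OF iz(1), of "inv k'"] by (simp add: m_assoc)
    also have "\<dots> = z \<otimes> z' \<otimes> ((inv z \<otimes> inv z') \<otimes> (k \<otimes> k' \<otimes> inv k \<otimes> inv k'))"
      using c Z_central[of "inv z \<otimes> inv z'" "k \<otimes> k' \<otimes> inv k \<otimes> inv k'"] iz Z(1)
      by (simp add: subgroup.m_closed)
    also have "z \<otimes> z' \<otimes> ((inv z \<otimes> inv z') \<otimes> (k \<otimes> k' \<otimes> inv k \<otimes> inv k')) = (z \<otimes> z' \<otimes> inv z \<otimes> inv z') \<otimes> (k \<otimes> k' \<otimes> inv k \<otimes> inv k')"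
      using c by (simp add: m_assoc)
    also have "z \<otimes> z' \<otimes> inv z \<otimes> inv z' = \<one>"
      using c Z_central[OF *(1) c(3)] by (simp add: m_assoc)
    finally show "x \<otimes> y \<otimes> inv x \<otimes> inv y \<in> DR"
      using * c DR_subgroup by (simp add: subgroup.m_closed subgroup.m_inv_closed)
  qed
  then have ZDR: "Z \<subseteq> DR" using derived_D[OF de] by simp
  then have "Z <#> DR \<subseteq> DR" using DR_subgroup by (auto simp: set_mult_def subgroup.m_closed)
  then show ?thesis using D_sub_ZDR by blast
qed

end

section \<open>The quotient of the wreath product base\<close>

locale class_two_group = group M for M (structure) +
  assumes commutator_central: "\<And>x y w. \<lbrakk>x \<in> carrier M; y \<in> carrier M; w \<in> carrier M\<rbrakk> \<Longrightarrow>
    x \<otimes> y \<otimes> inv x \<otimes> inv y \<otimes> w = w \<otimes> (x \<otimes> y \<otimes> inv x \<otimes> inv y)"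
begin

lemma commutator_hom_left: "w \<in> carrier M \<Longrightarrow> (\<lambda>x. x \<otimes> w \<otimes> inv x \<otimes> inv w) \<in> hom M M"
proof (rule homI)
  fix x y assume c: "w \<in> carrier M" "x \<in> carrier M" "y \<in> carrier M"
  have "x \<otimes> y \<otimes> w \<otimes> inv (x \<otimes> y) \<otimes> inv w = x \<otimes> (y \<otimes> w \<otimes> inv y \<otimes> inv w \<otimes> (w \<otimes> inv x \<otimes> inv w))"
    using c by (simp add: m_assoc inv_mult_group inv_mult_cancel)
  also have "y \<otimes> w \<otimes> inv y \<otimes> inv w \<otimes> (w \<otimes> inv x \<otimes> inv w) =
      w \<otimes> inv x \<otimes> inv w \<otimes> (y \<otimes> w \<otimes> inv y \<otimes> inv w)"
    using c by (intro commutator_central) auto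
  finally show "x \<otimes> y \<otimes> w \<otimes> inv (x \<otimes> y) \<otimes> inv w = x \<otimes> w \<otimes> inv x \<otimes> inv w \<otimes> (y \<otimes> w \<otimes> inv y \<otimes> inv w)"
    using c by (simp add: m_assoc)
qed simp

lemma commutator_hom_right: "w \<in> carrier M \<Longrightarrow> (\<lambda>x. w \<otimes> x \<otimes> inv w \<otimes> inv x) \<in> hom M M"
proof (rule homI)
  fix x y assume c: "w \<in> carrier M" "x \<in> carrier M" "y \<in> carrier M"
  have "w \<otimes> (x \<otimes> y) \<otimes> inv w \<otimes> inv (x \<otimes> y) = w \<otimes> x \<otimes> inv w \<otimes> (w \<otimes> y \<otimes> inv w \<otimes> inv y \<otimes> inv x)"
    using c by (simp add: m_assoc inv_mult_group inv_mult_cancel)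
  also have "w \<otimes> y \<otimes> inv w \<otimes> inv y \<otimes> inv x = inv x \<otimes> (w \<otimes> y \<otimes> inv w \<otimes> inv y)"
    using c by (intro commutator_central) auto
  finally show "w \<otimes> (x \<otimes> y) \<otimes> inv w \<otimes> inv (x \<otimes> y) = w \<otimes> x \<otimes> inv w \<otimes> inv x \<otimes> (w \<otimes> y \<otimes> inv w \<otimes> inv y)"
    using c by (simp add: m_assoc)
qed simp

text \<open>In class two the commutator is a homomorphism in each argument, so the exponents leave
  the two slots one after the other.\<close>

lemma commutator_int_pow:
  assumes "u \<in> carrier M" "v \<in> carrier M"
  shows "u [^] (a::int) \<otimes> v [^] (b::int) \<otimes> inv (u [^] a) \<otimes> inv (v [^] b) =
    (u \<otimes> v \<otimes> inv u \<otimes> inv v) [^] (a * b)"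
proof -
  have "u [^] a \<otimes> v [^] b \<otimes> inv (u [^] a) \<otimes> inv (v [^] b) = (u [^] a \<otimes> v \<otimes> inv (u [^] a) \<otimes> inv v) [^] b"
    using hom_int_pow[OF commutator_hom_right[of "u [^] a"], of v b] assms by (simp add: is_group)
  also have "u [^] a \<otimes> v \<otimes> inv (u [^] a) \<otimes> inv v = (u \<otimes> v \<otimes> inv u \<otimes> inv v) [^] a"
    using hom_int_pow[OF commutator_hom_left[of v], of u a] assms by (simp add: is_group)
  finally show ?thesis using assms by (simp add: int_pow_pow)
qed

end

lemma extraspecial_class_two:
  assumes "extraspecial M p" shows "class_two_group M"
proof -
  interpret group M using assms by (simp add: extraspecial_def)
  show ?thesis
  proof
    fix x y w assume *: "x \<in> carrier M" "y \<in> carrier M" "w \<in> carrier M"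
    then have "x \<otimes>\<^bsub>M\<^esub> y \<otimes>\<^bsub>M\<^esub> inv\<^bsub>M\<^esub> x \<otimes>\<^bsub>M\<^esub> inv\<^bsub>M\<^esub> y \<in> derived M (carrier M)"
      unfolding derived_def by (intro generate.incl) blast
    then show "x \<otimes>\<^bsub>M\<^esub> y \<otimes>\<^bsub>M\<^esub> inv\<^bsub>M\<^esub> x \<otimes>\<^bsub>M\<^esub> inv\<^bsub>M\<^esub> y \<otimes>\<^bsub>M\<^esub> w =
        w \<otimes>\<^bsub>M\<^esub> (x \<otimes>\<^bsub>M\<^esub> y \<otimes>\<^bsub>M\<^esub> inv\<^bsub>M\<^esub> x \<otimes>\<^bsub>M\<^esub> inv\<^bsub>M\<^esub> y)"
      using assms * by (simp add: extraspecial_def grp_center_def)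
  qed
qed

section \<open>The base group and the product of central coordinates\<close>

locale wreath_quotient = group G + M: class_two_group M
  for G (structure) and M :: "('m, 'c) monoid_scheme" +
  fixes H :: "'a set" and p :: nat
  assumes H: "subgroup H G" "finite H" and p: "Factorial_Ring.prime p" and M: "extraspecial M p"
begin

abbreviation "Z \<equiv> grp_center M"
abbreviation "Zg \<equiv> M\<lparr>carrier := Z\<rparr>"
abbreviation "B \<equiv> wr_base M H"
abbreviation "ZB \<equiv> (\<Pi>\<^sub>E x\<in>H. Z)"
definition "C = act_comm B (derived B (carrier B)) H (reg_act G H)"
text \<open>The product over all coordinates, taken in the abelian group \<open>Zg\<close> since
  \<open>M\<close> is not commutative. On \<open>ZB\<close> its kernel will turn out to be
  \<open>C\<close>, that is [B', H], which gives a membership test for \<open>C\<close>.\<close>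

definition "\<mu> f = finprod Zg f H"

lemma Z_eq: "Z = derived M (carrier M)" and card_Z: "card Z = p"
  using M by (auto simp: extraspecial_def)

lemma Z_subgroup: "subgroup Z M"
  unfolding Z_eq by (rule M.derived_is_subgroup) simp

lemma Z_carrier: "z \<in> Z \<Longrightarrow> z \<in> carrier M"
  by (simp add: grp_center_def)

lemma Z_comm: "z \<in> Z \<Longrightarrow> x \<in> carrier M \<Longrightarrow> z \<otimes>\<^bsub>M\<^esub> x = x \<otimes>\<^bsub>M\<^esub> z"
  by (simp add: grp_center_def)

lemma commutator_in_Z:
  "x \<in> carrier M \<Longrightarrow> y \<in> carrier M \<Longrightarrow> x \<otimes>\<^bsub>M\<^esub> y \<otimes>\<^bsub>M\<^esub> inv\<^bsub>M\<^esub> x \<otimes>\<^bsub>M\<^esub> inv\<^bsub>M\<^esub> y \<in> Z"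
  unfolding Z_eq derived_def by (intro generate.incl) blast

lemma Zg_comm_group: "comm_group Zg"
  by (rule group.group_comm_groupI[OF M.subgroup_imp_group[OF Z_subgroup]])
    (simp add: Z_comm Z_carrier)

sublocale Zg: comm_group Zg by (rule Zg_comm_group)

lemma B_carrier: "carrier B = (\<Pi>\<^sub>E x\<in>H. carrier M)"
  and B_mult: "f \<otimes>\<^bsub>B\<^esub> g = (\<lambda>x\<in>H. f x \<otimes>\<^bsub>M\<^esub> g x)"
  and B_one: "\<one>\<^bsub>B\<^esub> = (\<lambda>x\<in>H. \<one>\<^bsub>M\<^esub>)"
  by (simp_all add: wr_base_def)

lemma B_group: "group B"
  by (simp add: wr_base_def M.is_group)

sublocale B: group B by (rule B_group)

lemma B_inv: "f \<in> carrier B \<Longrightarrow> inv\<^bsub>B\<^esub> f = (\<lambda>x\<in>H. inv\<^bsub>M\<^esub> f x)"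
  using inv_product_group[of f H "\<lambda>_. M"] by (simp add: wr_base_def M.is_group)

lemma B_pow: "f \<in> carrier B \<Longrightarrow> f [^]\<^bsub>B\<^esub> (k::nat) = (\<lambda>x\<in>H. f x [^]\<^bsub>M\<^esub> k)"
proof (induction k)
  case (Suc k)
  then have "f [^]\<^bsub>B\<^esub> Suc k = (\<lambda>x\<in>H. (\<lambda>x\<in>H. f x [^]\<^bsub>M\<^esub> k) x \<otimes>\<^bsub>M\<^esub> f x)"
    by (simp add: B_mult)
  also have "\<dots> = (\<lambda>x\<in>H. f x [^]\<^bsub>M\<^esub> Suc k)" by (auto simp: restrict_def)
  finally show ?case .
qed (simp add: B_one)

lemma ZB_subgroup: "subgroup ZB B"
  unfolding wr_base_def
  using PiE_subgroup_product_group[of H "\<lambda>_. M" "\<lambda>_. Z"] Z_subgroup M.is_group by simp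

lemma ZB_carrier: "f \<in> ZB \<Longrightarrow> f \<in> carrier B"
  using subgroup.mem_carrier[OF ZB_subgroup] .

lemma ZB_comm: "f \<in> ZB \<Longrightarrow> g \<in> carrier B \<Longrightarrow> f \<otimes>\<^bsub>B\<^esub> g = g \<otimes>\<^bsub>B\<^esub> f"
  by (auto simp: B_mult B_carrier PiE_iff intro!: restrict_ext intro: Z_comm)

lemma B_commutator:
  assumes "f \<in> carrier B" "g \<in> carrier B"
  shows "f \<otimes>\<^bsub>B\<^esub> g \<otimes>\<^bsub>B\<^esub> inv\<^bsub>B\<^esub> f \<otimes>\<^bsub>B\<^esub> inv\<^bsub>B\<^esub> g =
    (\<lambda>x\<in>H. f x \<otimes>\<^bsub>M\<^esub> g x \<otimes>\<^bsub>M\<^esub> inv\<^bsub>M\<^esub> (f x) \<otimes>\<^bsub>M\<^esub> inv\<^bsub>M\<^esub> (g x))"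
  using assms by (auto simp: B_mult B_inv restrict_def fun_eq_iff)

lemma B_commutator_ZB:
  assumes "f \<in> carrier B" "g \<in> carrier B"
  shows "f \<otimes>\<^bsub>B\<^esub> g \<otimes>\<^bsub>B\<^esub> inv\<^bsub>B\<^esub> f \<otimes>\<^bsub>B\<^esub> inv\<^bsub>B\<^esub> g \<in> ZB"
  unfolding B_commutator[OF assms] using assms
  by (auto simp: B_carrier PiE_iff intro!: commutator_in_Z)

lemma derived_B: "derived B (carrier B) \<subseteq> ZB"
  unfolding derived_def
  by (rule B.generate_subgroup_incl[OF _ ZB_subgroup]) (use B_commutator_ZB in blast)

lemma mu_closed: "f \<in> ZB \<Longrightarrow> \<mu> f \<in> Z"
  unfolding \<mu>_def using Zg.finprod_closed[of f H] by (auto simp: PiE_iff)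

lemma mu_mult: "f \<in> ZB \<Longrightarrow> g \<in> ZB \<Longrightarrow> \<mu> (f \<otimes>\<^bsub>B\<^esub> g) = \<mu> f \<otimes>\<^bsub>M\<^esub> \<mu> g"
proof -
  assume *: "f \<in> ZB" "g \<in> ZB"
  then have "\<mu> (f \<otimes>\<^bsub>B\<^esub> g) = finprod Zg (\<lambda>x. f x \<otimes>\<^bsub>Zg\<^esub> g x) H"
    unfolding \<mu>_def B_mult by (intro Zg.finprod_cong') (auto simp: PiE_iff Pi_iff intro!: subgroup.m_closed[OF Z_subgroup])
  also have "\<dots> = finprod Zg f H \<otimes>\<^bsub>Zg\<^esub> finprod Zg g H"
    using * by (intro Zg.finprod_multf) (auto simp: PiE_iff)
  finally show ?thesis by (simp add: \<mu>_def)
qed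

lemma mu_hom: "\<mu> \<in> hom (B\<lparr>carrier := ZB\<rparr>) Zg"
  by (rule homI) (simp_all add: mu_closed mu_mult)

lemma mu_group_hom: "group_hom (B\<lparr>carrier := ZB\<rparr>) Zg \<mu>"
  using mu_hom B.subgroup_imp_group[OF ZB_subgroup] Zg.is_group
  by (simp add: group_hom_def group_hom_axioms_def)

lemma mu_inv: "f \<in> ZB \<Longrightarrow> \<mu> (inv\<^bsub>B\<^esub> f) = inv\<^bsub>M\<^esub> (\<mu> f)"
  using group_hom.hom_inv[OF mu_group_hom, of f] B.m_inv_consistent[OF ZB_subgroup, of f]
    M.m_inv_consistent[OF Z_subgroup mu_closed] by simp

lemma mu_one: "\<mu> \<one>\<^bsub>B\<^esub> = \<one>\<^bsub>M\<^esub>"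
  using group_hom.hom_one[OF mu_group_hom] by simp

definition "ker_mu = {f \<in> ZB. \<mu> f = \<one>\<^bsub>M\<^esub>}"

lemma ker_mu_subgroup: "subgroup ker_mu B"
proof (rule B.subgroupI)
  show "ker_mu \<subseteq> carrier B" using ZB_carrier by (auto simp: ker_mu_def)
  show "ker_mu \<noteq> {}" using mu_one subgroup.one_closed[OF ZB_subgroup] by (auto simp: ker_mu_def)
next
  fix f assume "f \<in> ker_mu"
  then show "inv\<^bsub>B\<^esub> f \<in> ker_mu"
    using subgroup.m_inv_closed[OF ZB_subgroup, of f] by (auto simp: ker_mu_def mu_inv)
next
  fix f g assume "f \<in> ker_mu" "g \<in> ker_mu"
  then show "f \<otimes>\<^bsub>B\<^esub> g \<in> ker_mu"
    using subgroup.m_closed[OF ZB_subgroup, of f g] by (auto simp: ker_mu_def mu_mult)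
qed

lemma shift_in_H: "g \<in> H \<Longrightarrow> x \<in> H \<Longrightarrow> x \<otimes> inv g \<in> H"
  by (simp add: subgroup.m_closed[OF H(1)] subgroup.m_inv_closed[OF H(1)])

lemma H_carrier: "g \<in> H \<Longrightarrow> g \<in> carrier G"
  using subgroup.mem_carrier[OF H(1)] .

lemma reg_act_closed: "g \<in> H \<Longrightarrow> f \<in> carrier B \<Longrightarrow> reg_act G H g f \<in> carrier B"
  using shift_in_H by (auto simp: reg_act_def B_carrier PiE_iff)

lemma reg_act_ZB: "g \<in> H \<Longrightarrow> f \<in> ZB \<Longrightarrow> reg_act G H g f \<in> ZB"
  using shift_in_H by (auto simp: reg_act_def PiE_iff)

lemma reg_act_hom: "g \<in> H \<Longrightarrow> reg_act G H g \<in> hom B B"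
  by (rule homI) (auto simp: reg_act_closed, auto simp: reg_act_def B_mult shift_in_H intro!: restrict_ext)

lemma reg_act_mult:
  "g \<in> H \<Longrightarrow> h \<in> H \<Longrightarrow> reg_act G H (g \<otimes> h) f = reg_act G H h (reg_act G H g f)"
  by (auto simp: reg_act_def shift_in_H inv_mult_group m_assoc H_carrier intro!: restrict_ext)

lemma reg_act_one: "f \<in> carrier B \<Longrightarrow> reg_act G H \<one> f = f"
  by (auto simp: reg_act_def B_carrier PiE_iff H_carrier extensional_def restrict_def fun_eq_iff)

lemma shift_bij: "g \<in> H \<Longrightarrow> bij_betw (\<lambda>x. x \<otimes> inv g) H H"
proof (rule bij_betwI[where g = "\<lambda>x. x \<otimes> g"])
  assume g: "g \<in> H"
  show "(\<lambda>x. x \<otimes> inv g) \<in> H \<rightarrow> H" using g shift_in_H by auto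
  show "(\<lambda>x. x \<otimes> g) \<in> H \<rightarrow> H" using g subgroup.m_closed[OF H(1)] by auto
qed (simp_all add: m_assoc H_carrier)

text \<open>The regular action permutes the coordinates, and a product in an abelian group does not
  depend on their order.\<close>

lemma mu_reg_act: "g \<in> H \<Longrightarrow> f \<in> ZB \<Longrightarrow> \<mu> (reg_act G H g f) = \<mu> f"
proof -
  assume *: "g \<in> H" "f \<in> ZB"
  have "\<mu> f = finprod Zg f ((\<lambda>x. x \<otimes> inv g) ` H)"
    using shift_bij[OF *(1)] by (simp add: \<mu>_def bij_betw_def)
  also have "\<dots> = finprod Zg (\<lambda>x. f (x \<otimes> inv g)) H"
    using shift_bij[OF *(1)] * by (intro Zg.finprod_reindex) (auto simp: bij_betw_def PiE_iff)
  also have "\<dots> = \<mu> (reg_act G H g f)"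
    unfolding \<mu>_def reg_act_def using * shift_in_H
    by (intro Zg.finprod_cong') (auto simp: PiE_iff)
  finally show ?thesis by simp
qed

text \<open>\<open>\<mu>\<close> is a homomorphism on \<open>ZB\<close> that is invariant under
  \<open>H\<close>, so it kills each quotient of an element and its translate.\<close>

lemma C_gens: "(\<lambda>(a, b). inv\<^bsub>B\<^esub> a \<otimes>\<^bsub>B\<^esub> reg_act G H b a) ` (derived B (carrier B) \<times> H) \<subseteq> ker_mu"
proof clarify
  fix f g assume "f \<in> derived B (carrier B)" "g \<in> H"
  then have *: "f \<in> ZB" "g \<in> H" using derived_B by auto
  then have i: "inv\<^bsub>B\<^esub> f \<in> ZB" "reg_act G H g f \<in> ZB"
    using subgroup.m_inv_closed[OF ZB_subgroup] reg_act_ZB by auto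
  then have "\<mu> (inv\<^bsub>B\<^esub> f \<otimes>\<^bsub>B\<^esub> reg_act G H g f) = \<one>\<^bsub>M\<^esub>"
    using * mu_closed[of f] by (simp add: mu_mult mu_inv mu_reg_act Z_carrier)
  then show "inv\<^bsub>B\<^esub> f \<otimes>\<^bsub>B\<^esub> reg_act G H g f \<in> ker_mu"
    using subgroup.m_closed[OF ZB_subgroup i] by (simp add: ker_mu_def)
qed

lemma C_subset_ker_mu: "C \<subseteq> ker_mu"
  unfolding C_def act_comm_def by (rule B.generate_subgroup_incl[OF C_gens ker_mu_subgroup])

lemma C_subgroup: "subgroup C B"
  unfolding C_def act_comm_def
  by (rule B.generate_is_subgroup) (use C_gens subgroup.subset[OF ker_mu_subgroup] in blast)

text \<open>\<open>\<kappa>\<close> is read as an element of the integral group ring of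
  \<open>H\<close>, with \<open>ind h\<close> the basis element \<open>h\<close>. For fixed
  \<open>u\<close>, addition becomes multiplication in \<open>B\<close>, and \<open>g\<close> acts
  as right multiplication by \<open>g\<close>.\<close>

definition E :: "'m \<Rightarrow> ('a \<Rightarrow> int) \<Rightarrow> 'a \<Rightarrow> 'm" where
  "E u \<kappa> = (\<lambda>x\<in>H. u [^]\<^bsub>M\<^esub> \<kappa> x)"

abbreviation ind :: "'a \<Rightarrow> 'a \<Rightarrow> int" where
  "ind h \<equiv> (\<lambda>x. if x = h then 1 else 0)"

lemma E_closed: "u \<in> carrier M \<Longrightarrow> E u \<kappa> \<in> carrier B"
  by (auto simp: E_def B_carrier)

lemma E_ZB: "z \<in> Z \<Longrightarrow> E z \<kappa> \<in> ZB"
  using M.subgroup_int_pow_closed[OF Z_subgroup] by (auto simp: E_def)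

lemma E_add: "u \<in> carrier M \<Longrightarrow> E u \<kappa> \<otimes>\<^bsub>B\<^esub> E u l = E u (\<lambda>x. \<kappa> x + l x)"
  by (auto simp: E_def B_mult M.int_pow_mult intro!: restrict_ext)

lemma E_minus: "u \<in> carrier M \<Longrightarrow> inv\<^bsub>B\<^esub> (E u \<kappa>) = E u (\<lambda>x. - \<kappa> x)"
  by (simp add: B_inv E_closed) (auto simp: E_def M.int_pow_neg intro!: restrict_ext)

lemma E_shift: "g \<in> H \<Longrightarrow> reg_act G H g (E u \<kappa>) = E u (\<lambda>x. \<kappa> (x \<otimes> inv g))"
  by (auto simp: E_def reg_act_def shift_in_H intro!: restrict_ext)

lemma E_cong: "(\<And>x. x \<in> H \<Longrightarrow> \<kappa> x = l x) \<Longrightarrow> E u \<kappa> = E u l"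
  by (auto simp: E_def intro!: restrict_ext)

lemma E_shift_ind:
  assumes "g \<in> H" "h \<in> H" shows "reg_act G H g (E u (ind h)) = E u (ind (h \<otimes> g))"
  unfolding E_shift[OF assms(1)] using assms
  by (intro E_cong) (auto simp: m_assoc H_carrier)

lemma E_ind_hom: "(\<lambda>u. E u (ind h)) \<in> hom M B"
  by (rule homI) (auto simp: E_closed, auto simp: E_def B_mult intro!: restrict_ext)

text \<open>Placing an element of \<open>M\<close> at coordinate \<open>h\<close> is a homomorphism
  into \<open>B\<close>, and \<open>Z\<close> is the derived subgroup of \<open>M\<close>.\<close>

lemma E_ind_derived: "z \<in> Z \<Longrightarrow> E z (ind h) \<in> derived B (carrier B)"
proof -
  assume z: "z \<in> Z"
  interpret e: group_hom M B "\<lambda>u. E u (ind h)"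
    by unfold_locales (rule E_ind_hom)
  have "E z (ind h) \<in> (\<lambda>u. E u (ind h)) ` derived M (carrier M)" using z Z_eq by blast
  also have "\<dots> = derived B ((\<lambda>u. E u (ind h)) ` carrier M)" by (rule e.derived_img[symmetric]) simp
  also have "\<dots> \<subseteq> derived B (carrier B)" by (rule B.mono_derived) (auto simp: E_closed)
  finally show ?thesis .
qed

lemma E_add_left: "u \<in> Z \<Longrightarrow> v \<in> Z \<Longrightarrow> E u (ind h) \<otimes>\<^bsub>B\<^esub> E v (ind h) = E (u \<otimes>\<^bsub>M\<^esub> v) (ind h)"
  using hom_mult[OF E_ind_hom] Z_carrier by metis

lemma mu_E: "z \<in> Z \<Longrightarrow> \<mu> (E z \<kappa>) = z [^]\<^bsub>M\<^esub> (\<Sum>x\<in>H. \<kappa> x)"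
proof -
  assume z: "z \<in> Z"
  have "finprod Zg (E z \<kappa>) S = z [^]\<^bsub>M\<^esub> (\<Sum>x\<in>S. \<kappa> x)" if "S \<subseteq> H" for S
    using finite_subset[OF that H(2)] that
  proof (induction S)
    case (insert x S)
    have "finprod Zg (E z \<kappa>) (insert x S) = E z \<kappa> x \<otimes>\<^bsub>Zg\<^esub> finprod Zg (E z \<kappa>) S"
      using insert E_ZB[OF z, of \<kappa>] by (intro Zg.finprod_insert) (auto simp: PiE_iff)
    also have "finprod Zg (E z \<kappa>) S = z [^]\<^bsub>M\<^esub> (\<Sum>x\<in>S. \<kappa> x)"
      using insert by blast
    also have "E z \<kappa> x = z [^]\<^bsub>M\<^esub> \<kappa> x" using insert by (simp add: E_def)
    finally show ?case
      using insert.hyps z by (simp add: M.int_pow_mult Z_carrier)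
  qed simp
  then show ?thesis by (simp add: \<mu>_def)
qed

section \<open>The quotient of the base group by [B', H]\<close>

lemma C_normal: "C \<lhd> B"
proof (rule B.normal_invI[OF C_subgroup])
  fix x h assume *: "x \<in> carrier B" "h \<in> C"
  then have h: "h \<in> ZB" using C_subset_ker_mu by (auto simp: ker_mu_def)
  then have "x \<otimes>\<^bsub>B\<^esub> h \<otimes>\<^bsub>B\<^esub> inv\<^bsub>B\<^esub> x = h \<otimes>\<^bsub>B\<^esub> x \<otimes>\<^bsub>B\<^esub> inv\<^bsub>B\<^esub> x"
    using * ZB_comm[OF h] by simp
  also have "\<dots> = h" using * ZB_carrier[OF h] by (simp add: B.m_assoc)
  finally show "x \<otimes>\<^bsub>B\<^esub> h \<otimes>\<^bsub>B\<^esub> inv\<^bsub>B\<^esub> x \<in> C" using * by simp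
qed

sublocale C: normal C B by (rule C_normal)

abbreviation "Q \<equiv> quot_base G H M"
abbreviation "cl f \<equiv> C #>\<^bsub>B\<^esub> f"

lemma Q_eq: "Q = B Mod C"
  by (simp add: quot_base_def C_def Let_def)

lemma cl_hom: "group_hom B Q cl"
  unfolding Q_eq using C.factorgroup_is_group C.r_coset_hom_Mod B.is_group
  by (simp add: group_hom_def group_hom_axioms_def)

sublocale cl: group_hom B Q cl by (rule cl_hom)

lemma carrier_Q: "carrier Q = cl ` carrier B"
  unfolding Q_eq by (simp add: carrier_FactGroup)

lemma cl_eq_one: "f \<in> carrier B \<Longrightarrow> cl f = \<one>\<^bsub>Q\<^esub> \<longleftrightarrow> f \<in> C"
  using B.coset_join1[of C f] B.coset_join2[of f C] C.subset C.subgroup_axioms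
  by (auto simp: Q_eq)

lemma cl_eqI:
  assumes "f \<in> carrier B" "g \<in> carrier B" "inv\<^bsub>B\<^esub> f \<otimes>\<^bsub>B\<^esub> g \<in> C" shows "cl f = cl g"
proof -
  have "inv\<^bsub>Q\<^esub> cl f \<otimes>\<^bsub>Q\<^esub> cl g = \<one>\<^bsub>Q\<^esub>"
    using assms cl_eq_one[of "inv\<^bsub>B\<^esub> f \<otimes>\<^bsub>B\<^esub> g"] by simp
  then have "inv\<^bsub>Q\<^esub> (inv\<^bsub>Q\<^esub> cl f) = cl g"
    using assms by (intro cl.H.inv_equality) (auto simp: cl.H.inv_comm)
  then show ?thesis using assms by simp
qed

text \<open>\<open>C\<close> lies in the kernel of \<open>\<mu>\<close>, which therefore is an
  invariant of the cosets of central functions.\<close>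

lemma mu_cong:
  assumes f: "f \<in> ZB" and g: "g \<in> ZB" and eq: "cl f = cl g" shows "\<mu> f = \<mu> g"
proof -
  have c: "f \<in> carrier B" "g \<in> carrier B" using f g ZB_carrier by auto
  have "cl (inv\<^bsub>B\<^esub> f \<otimes>\<^bsub>B\<^esub> g) = \<one>\<^bsub>Q\<^esub>" using c eq by simp
  then have "inv\<^bsub>B\<^esub> f \<otimes>\<^bsub>B\<^esub> g \<in> ker_mu"
    using cl_eq_one[of "inv\<^bsub>B\<^esub> f \<otimes>\<^bsub>B\<^esub> g"] C_subset_ker_mu c by blast
  then have "inv\<^bsub>M\<^esub> (\<mu> f) \<otimes>\<^bsub>M\<^esub> \<mu> g = \<one>\<^bsub>M\<^esub>"
    using mu_mult[of "inv\<^bsub>B\<^esub> f" g] subgroup.m_inv_closed[OF ZB_subgroup f] f g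
    by (simp add: ker_mu_def mu_inv)
  then have "inv\<^bsub>M\<^esub> (\<mu> g) = inv\<^bsub>M\<^esub> (\<mu> f)"
    using f g mu_closed Z_carrier by (intro M.inv_equality) auto
  then show ?thesis
    using f g mu_closed Z_carrier by (metis M.inv_inv)
qed

text \<open>Acting by \<open>h\<close> moves the entry at \<open>\<one>\<close> to coordinate
  \<open>h\<close>, so the two functions differ by a generator of [B', H].\<close>

lemma cl_E_ind:
  assumes z: "z \<in> Z" and h: "h \<in> H" shows "cl (E z (ind h)) = cl (E z (ind \<one>))"
proof (rule cl_eqI[symmetric])
  have "reg_act G H h (E z (ind \<one>)) = E z (ind h)"
    using E_shift_ind[OF h subgroup.one_closed[OF H(1)]] H_carrier[OF h] by simp
  then have "(inv\<^bsub>B\<^esub> E z (ind \<one>)) \<otimes>\<^bsub>B\<^esub> E z (ind h) \<in>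
      (\<lambda>(a, b). inv\<^bsub>B\<^esub> a \<otimes>\<^bsub>B\<^esub> reg_act G H b a) ` (derived B (carrier B) \<times> H)"
    using E_ind_derived[OF z, of \<one>] h by force
  then show "(inv\<^bsub>B\<^esub> E z (ind \<one>)) \<otimes>\<^bsub>B\<^esub> E z (ind h) \<in> C"
    unfolding C_def act_comm_def by (rule generate.incl)
qed (use z E_closed Z_carrier in auto)

text \<open>Modulo \<open>C\<close> every central entry may be moved to coordinate
  \<open>\<one>\<close>. The induction runs over a set \<open>S\<close> containing the support and
  moves one coordinate at a time.\<close>

lemma cl_ZB:
  assumes f: "f \<in> ZB" shows "\<exists>z\<in>Z. cl f = cl (E z (ind \<one>))"
proof -
  have "\<forall>f\<in>ZB. (\<forall>x\<in>H - S. f x = \<one>\<^bsub>M\<^esub>) \<longrightarrow> (\<exists>z\<in>Z. cl f = cl (E z (ind \<one>)))" if "S \<subseteq> H" for S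
    using finite_subset[OF that H(2)] that
  proof (induction S)
    case empty
    have "f = E \<one>\<^bsub>M\<^esub> (ind \<one>)" if "f \<in> ZB" "\<forall>x\<in>H. f x = \<one>\<^bsub>M\<^esub>" for f
      using that by (auto simp: E_def fun_eq_iff PiE_iff extensional_def)
    then show ?case using subgroup.one_closed[OF Z_subgroup] by auto
  next
    case (insert x S)
    show ?case
    proof (intro ballI impI)
      fix f assume f: "f \<in> ZB" "\<forall>y\<in>H - insert x S. f y = \<one>\<^bsub>M\<^esub>"
      define f' where "f' = (\<lambda>y\<in>H. if y = x then \<one>\<^bsub>M\<^esub> else f y)"
      have f': "f' \<in> ZB" "\<forall>y\<in>H - S. f' y = \<one>\<^bsub>M\<^esub>"
        using f subgroup.one_closed[OF Z_subgroup] by (auto simp: f'_def PiE_iff)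
      then obtain z where z: "z \<in> Z" "cl f' = cl (E z (ind \<one>))" using insert by auto
      have fx: "f x \<in> Z" using f insert.prems by (auto simp: PiE_iff)
      have "f = E (f x) (ind x) \<otimes>\<^bsub>B\<^esub> f'"
        using f fx insert.prems
        by (auto simp: E_def B_mult f'_def fun_eq_iff PiE_iff extensional_def Z_carrier)
      then have "cl f = cl (E (f x) (ind x)) \<otimes>\<^bsub>Q\<^esub> cl f'"
        using cl.hom_mult[OF E_closed ZB_carrier] fx f' Z_carrier by metis
      also have "\<dots> = cl (E (f x) (ind \<one>)) \<otimes>\<^bsub>Q\<^esub> cl (E z (ind \<one>))"
        using z cl_E_ind[OF fx] insert.prems by simp
      also have "\<dots> = cl (E (f x) (ind \<one>) \<otimes>\<^bsub>B\<^esub> E z (ind \<one>))"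
        using fx z Z_carrier E_closed by (intro cl.hom_mult[symmetric]) auto
      also have "\<dots> = cl (E (f x \<otimes>\<^bsub>M\<^esub> z) (ind \<one>))"
        using fx z by (simp add: E_add_left)
      finally show "\<exists>z\<in>Z. cl f = cl (E z (ind \<one>))"
        using subgroup.m_closed[OF Z_subgroup fx z(1)] by blast
    qed
  qed
  from this[of H] f show ?thesis by simp
qed

lemma mu_E_one: "z \<in> Z \<Longrightarrow> \<mu> (E z (ind \<one>)) = z"
  using subgroup.one_closed[OF H(1)] H(2) by (simp add: mu_E Z_carrier)

text \<open>An element of the kernel is congruent modulo \<open>C\<close> to some
  \<open>E z (ind \<one>)\<close>, from which \<open>\<mu>\<close> reads off \<open>z\<close>; so
  \<open>z\<close> is trivial. In this description the invariance of \<open>C\<close> under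
  \<open>H\<close> is evident.\<close>

lemma C_eq_ker_mu: "C = ker_mu"
proof
  show "ker_mu \<subseteq> C"
  proof
    fix f assume f: "f \<in> ker_mu"
    then have fZ: "f \<in> ZB" by (simp add: ker_mu_def)
    obtain z where z: "z \<in> Z" "cl f = cl (E z (ind \<one>))" using cl_ZB[OF fZ] by blast
    have e: "E z (ind \<one>) \<in> ZB" by (rule E_ZB[OF z(1)])
    have "z = \<one>\<^bsub>M\<^esub>" using mu_cong[OF fZ e z(2)] mu_E_one[OF z(1)] f by (simp add: ker_mu_def)
    then have "E z (ind \<one>) = \<one>\<^bsub>B\<^esub>" by (auto simp: E_def B_one fun_eq_iff)
    then have "cl f = \<one>\<^bsub>Q\<^esub>" using z by simp
    then show "f \<in> C" using cl_eq_one ZB_carrier fZ by blast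
  qed
qed (rule C_subset_ker_mu)

section \<open>The central subgroup of order p\<close>

definition "Zbar = cl ` ZB"

lemma Zbar_subgroup: "subgroup Zbar Q"
  unfolding Zbar_def by (rule cl.subgroup_img_is_subgroup[OF ZB_subgroup])

text \<open>The |H| copies of the centre of \<open>M\<close> collapse to one: \<open>cl_ZB\<close>
  gives surjectivity, and injectivity holds because \<open>\<mu>\<close> recovers
  \<open>z\<close>.\<close>

lemma card_Zbar: "card Zbar = p"
proof -
  have "bij_betw (\<lambda>z. cl (E z (ind \<one>))) Z Zbar"
    unfolding bij_betw_def
  proof
    show "inj_on (\<lambda>z. cl (E z (ind \<one>))) Z"
    proof (rule inj_onI)
      fix y z assume *: "y \<in> Z" "z \<in> Z" "cl (E y (ind \<one>)) = cl (E z (ind \<one>))"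
      then show "y = z"
        using mu_cong[OF E_ZB E_ZB] mu_E_one by metis
    qed
    show "(\<lambda>z. cl (E z (ind \<one>))) ` Z = Zbar"
      using cl_ZB E_ZB by (fastforce simp: Zbar_def)
  qed
  then show ?thesis using card_Z bij_betw_same_card by metis
qed

lemma Zbar_central:
  assumes "z \<in> Zbar" "x \<in> carrier Q" shows "z \<otimes>\<^bsub>Q\<^esub> x = x \<otimes>\<^bsub>Q\<^esub> z"
proof -
  obtain f g where *: "f \<in> ZB" "g \<in> carrier B" "z = cl f" "x = cl g"
    using assms by (auto simp: Zbar_def carrier_Q)
  have "cl f \<otimes>\<^bsub>Q\<^esub> cl g = cl (f \<otimes>\<^bsub>B\<^esub> g)"
    using * ZB_carrier by simp
  also have "f \<otimes>\<^bsub>B\<^esub> g = g \<otimes>\<^bsub>B\<^esub> f" using * by (intro ZB_comm)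
  also have "cl (g \<otimes>\<^bsub>B\<^esub> f) = cl g \<otimes>\<^bsub>Q\<^esub> cl f"
    using * ZB_carrier by simp
  finally show ?thesis using * by simp
qed

lemma Q_commutator:
  assumes "x \<in> carrier Q" "y \<in> carrier Q"
  shows "x \<otimes>\<^bsub>Q\<^esub> y \<otimes>\<^bsub>Q\<^esub> inv\<^bsub>Q\<^esub> x \<otimes>\<^bsub>Q\<^esub> inv\<^bsub>Q\<^esub> y \<in> Zbar"
proof -
  obtain f g where *: "f \<in> carrier B" "g \<in> carrier B" "x = cl f" "y = cl g"
    using assms by (auto simp: carrier_Q)
  then have "x \<otimes>\<^bsub>Q\<^esub> y \<otimes>\<^bsub>Q\<^esub> inv\<^bsub>Q\<^esub> x \<otimes>\<^bsub>Q\<^esub> inv\<^bsub>Q\<^esub> y = cl (f \<otimes>\<^bsub>B\<^esub> g \<otimes>\<^bsub>B\<^esub> inv\<^bsub>B\<^esub> f \<otimes>\<^bsub>B\<^esub> inv\<^bsub>B\<^esub> g)"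
    by simp
  then show ?thesis using B_commutator_ZB[OF *(1,2)] by (auto simp: Zbar_def)
qed

lemma Q_exponent:
  assumes n: "card (carrier M) = p ^ n" and x: "x \<in> carrier Q"
  shows "x [^]\<^bsub>Q\<^esub> (p ^ n) = \<one>\<^bsub>Q\<^esub>"
proof -
  obtain f where f: "f \<in> carrier B" "x = cl f" using x by (auto simp: carrier_Q)
  have "f [^]\<^bsub>B\<^esub> (p ^ n) = \<one>\<^bsub>B\<^esub>"
    using f M.pow_order_eq_1 n by (auto simp: B_pow B_one order_def B_carrier PiE_iff intro!: restrict_ext)
  then show ?thesis using cl.hom_nat_pow[OF f(1), of "p ^ n"] f by simp
qed

section \<open>The induced action on the quotient\<close>

lemma reg_act_C: "g \<in> H \<Longrightarrow> f \<in> C \<Longrightarrow> reg_act G H g f \<in> C"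
  by (simp add: C_eq_ker_mu ker_mu_def reg_act_ZB mu_reg_act)

text \<open>\<open>coset_act\<close> takes the image of a whole coset. Since \<open>C\<close> is
  mapped onto itself, by invariance under \<open>g\<close> and \<open>inv g\<close>, the action may
  be computed on representatives.\<close>

lemma coset_act_cl:
  assumes g: "g \<in> H" and f: "f \<in> carrier B"
  shows "coset_act G H g (cl f) = cl (reg_act G H g f)"
proof -
  interpret r: group_hom B B "reg_act G H g" by unfold_locales (rule reg_act_hom[OF g])
  have ig: "inv g \<in> H" using g H by (simp add: subgroup.m_inv_closed)
  have "reg_act G H g ` C = C"
  proof
    show "C \<subseteq> reg_act G H g ` C"
    proof
      fix c assume c: "c \<in> C"
      then have "c = reg_act G H g (reg_act G H (inv g) c)"
        using reg_act_mult[OF ig g, of c] g C.subset by (simp add: H_carrier reg_act_one subset_iff)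
      then show "c \<in> reg_act G H g ` C" using reg_act_C[OF ig c] by blast
    qed
  qed (use reg_act_C[OF g] in blast)
  moreover have "coset_act G H g (cl f) = (reg_act G H g ` C) #>\<^bsub>B\<^esub> reg_act G H g f"
  proof -
    have "reg_act G H g (c \<otimes>\<^bsub>B\<^esub> f) = reg_act G H g c \<otimes>\<^bsub>B\<^esub> reg_act G H g f" if "c \<in> C" for c
      using that f C.subset by (intro r.hom_mult) auto
    then show ?thesis
      unfolding coset_act_def r_coset_def image_UN by simp
  qed
  ultimately show ?thesis by simp
qed

lemma coset_act_closed: "g \<in> H \<Longrightarrow> x \<in> carrier Q \<Longrightarrow> coset_act G H g x \<in> carrier Q"
  using reg_act_closed by (auto simp: carrier_Q coset_act_cl)

lemma coset_act_hom: "g \<in> H \<Longrightarrow> coset_act G H g \<in> hom Q Q"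
proof (rule homI)
  fix x y assume "g \<in> H" "x \<in> carrier Q" "y \<in> carrier Q"
  then show "coset_act G H g (x \<otimes>\<^bsub>Q\<^esub> y) = coset_act G H g x \<otimes>\<^bsub>Q\<^esub> coset_act G H g y"
    using hom_mult[OF reg_act_hom]
    by (auto simp: carrier_Q coset_act_cl reg_act_closed cl.hom_mult[symmetric] simp del: cl.hom_mult)
qed (rule coset_act_closed)

lemma coset_act_mult:
  "g \<in> H \<Longrightarrow> h \<in> H \<Longrightarrow> x \<in> carrier Q \<Longrightarrow>
    coset_act G H (g \<otimes> h) x = coset_act G H h (coset_act G H g x)"
  using subgroup.m_closed[OF H(1)] by (auto simp: carrier_Q coset_act_cl reg_act_closed reg_act_mult)

lemma coset_act_one: "x \<in> carrier Q \<Longrightarrow> coset_act G H \<one> x = x"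
  using subgroup.one_closed[OF H(1)] by (auto simp: carrier_Q coset_act_cl reg_act_one)

section \<open>The commutator pairing and the group ring\<close>

lemma ex_commutator_nontrivial:
  obtains u v where "u \<in> carrier M" "v \<in> carrier M"
    "u \<otimes>\<^bsub>M\<^esub> v \<otimes>\<^bsub>M\<^esub> inv\<^bsub>M\<^esub> u \<otimes>\<^bsub>M\<^esub> inv\<^bsub>M\<^esub> v \<noteq> \<one>\<^bsub>M\<^esub>"
proof -
  have "\<exists>u\<in>carrier M. \<exists>v\<in>carrier M. u \<otimes>\<^bsub>M\<^esub> v \<otimes>\<^bsub>M\<^esub> inv\<^bsub>M\<^esub> u \<otimes>\<^bsub>M\<^esub> inv\<^bsub>M\<^esub> v \<noteq> \<one>\<^bsub>M\<^esub>"
  proof (rule ccontr)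
    assume "\<not> ?thesis"
    then have "derived M (carrier M) \<subseteq> {\<one>\<^bsub>M\<^esub>}"
      unfolding derived_def by (intro M.generate_subgroup_incl M.triv_subgroup) auto
    then have "card Z \<le> 1" unfolding Z_eq using card_mono[of "{\<one>\<^bsub>M\<^esub>}"] by simp
    then show False using card_Z prime_gt_1_nat[OF p] by simp
  qed
  then show thesis using that by blast
qed

lemma Z_pow_eq_one:
  assumes z: "z \<in> Z" "z \<noteq> \<one>\<^bsub>M\<^esub>" shows "z [^]\<^bsub>M\<^esub> (k::int) = \<one>\<^bsub>M\<^esub> \<longleftrightarrow> int p dvd k"
proof -
  have zc: "z \<in> carrier M" using z Z_carrier by simp
  have "z [^]\<^bsub>M\<^esub> p = \<one>\<^bsub>M\<^esub>"
    using Zg.pow_order_eq_1[of z] z card_Z by (simp add: order_def nat_pow_def)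
  then have "M.ord z dvd p" using M.pow_eq_id[OF zc] by simp
  moreover have "M.ord z \<noteq> 1" using M.ord_eq_1[OF zc] z by simp
  ultimately have "M.ord z = p" using p prime_nat_iff by blast
  then show ?thesis using M.int_pow_eq_id[OF zc] by simp
qed

text \<open>The map \<open>\<mu>\<close> sends the commutator of the representatives to \<open>[u, v]\<close> raised to the power \<open>\<Sum>x. \<kappa> x * l x\<close>.\<close>

lemma cl_E_commute_imp:
  assumes uv: "u \<in> carrier M" "v \<in> carrier M"
    "u \<otimes>\<^bsub>M\<^esub> v \<otimes>\<^bsub>M\<^esub> inv\<^bsub>M\<^esub> u \<otimes>\<^bsub>M\<^esub> inv\<^bsub>M\<^esub> v \<noteq> \<one>\<^bsub>M\<^esub>"
    and comm: "cl (E u \<kappa>) \<otimes>\<^bsub>Q\<^esub> cl (E v l) = cl (E v l) \<otimes>\<^bsub>Q\<^esub> cl (E u \<kappa>)"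
  shows "int p dvd (\<Sum>x\<in>H. \<kappa> x * l x)"
proof -
  let ?z = "u \<otimes>\<^bsub>M\<^esub> v \<otimes>\<^bsub>M\<^esub> inv\<^bsub>M\<^esub> u \<otimes>\<^bsub>M\<^esub> inv\<^bsub>M\<^esub> v"
  let ?f = "E u \<kappa>" and ?g = "E v l"
  have z: "?z \<in> Z" using commutator_in_Z uv by blast
  have c: "?f \<in> carrier B" "?g \<in> carrier B" using uv E_closed by auto
  have "cl (?f \<otimes>\<^bsub>B\<^esub> ?g \<otimes>\<^bsub>B\<^esub> inv\<^bsub>B\<^esub> ?f \<otimes>\<^bsub>B\<^esub> inv\<^bsub>B\<^esub> ?g) =
      cl ?g \<otimes>\<^bsub>Q\<^esub> cl ?f \<otimes>\<^bsub>Q\<^esub> inv\<^bsub>Q\<^esub> cl ?f \<otimes>\<^bsub>Q\<^esub> inv\<^bsub>Q\<^esub> cl ?g"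
    using c comm by simp
  also have "\<dots> = \<one>\<^bsub>Q\<^esub>" using c by (simp add: cl.H.m_assoc)
  finally have "?f \<otimes>\<^bsub>B\<^esub> ?g \<otimes>\<^bsub>B\<^esub> inv\<^bsub>B\<^esub> ?f \<otimes>\<^bsub>B\<^esub> inv\<^bsub>B\<^esub> ?g \<in> ker_mu"
    using c cl_eq_one[of "?f \<otimes>\<^bsub>B\<^esub> ?g \<otimes>\<^bsub>B\<^esub> inv\<^bsub>B\<^esub> ?f \<otimes>\<^bsub>B\<^esub> inv\<^bsub>B\<^esub> ?g"] C_subset_ker_mu by auto
  moreover have "?f \<otimes>\<^bsub>B\<^esub> ?g \<otimes>\<^bsub>B\<^esub> inv\<^bsub>B\<^esub> ?f \<otimes>\<^bsub>B\<^esub> inv\<^bsub>B\<^esub> ?g = E ?z (\<lambda>x. \<kappa> x * l x)"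
    unfolding B_commutator[OF c]
    by (auto simp: E_def M.commutator_int_pow uv intro!: restrict_ext)
  ultimately have "?z [^]\<^bsub>M\<^esub> (\<Sum>x\<in>H. \<kappa> x * l x) = \<one>\<^bsub>M\<^esub>"
    using mu_E[OF z] by (simp add: ker_mu_def)
  then show ?thesis using Z_pow_eq_one[OF z uv(3)] by simp
qed

end

text \<open>Here \<open>\<kappa> r\<close> is the coefficient function of the group ring element \<open>(1 - r)(1 - x)\<close>. Were it
  constant modulo \<open>p\<close> on \<open>R\<close>, the constant would be \<open>0\<close>, because the coefficients over \<open>R\<close> sum to
  \<open>0\<close> and \<open>p\<close> does not divide \<open>|R|\<close>. For \<open>x \<in> R\<close> the choice \<open>r = x\<^sup>-\<^sup>1\<close> is used.\<close>

lemma (in group) indicator_difference_mod: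
  assumes R: "subgroup R G" "card R = q" "Factorial_Ring.prime q"
    and p: "Factorial_Ring.prime p" "p \<noteq> q" and x: "x \<in> carrier G" "x \<noteq> \<one>"
  defines "\<kappa> \<equiv> \<lambda>r y. ((if y = r \<otimes> x then 1 else 0) - (if y = x then 1 else 0)
      - ((if y = r then 1 else 0) - (if y = \<one> then 1 else 0)) :: int)"
  shows "\<exists>r\<in>R. \<exists>s\<in>R. \<not> int p dvd \<kappa> r s - \<kappa> r \<one>"
proof (rule ccontr)
  assume "\<not> ?thesis"
  then have dvd: "int p dvd \<kappa> r s - \<kappa> r \<one>" if "r \<in> R" "s \<in> R" for r s using that by blast
  have fin: "finite R" using R(2,3) by (metis card.infinite not_prime_0)
  have one: "\<one> \<in> R" by (rule subgroup.one_closed[OF R(1)])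
  have sum_dvd: "int p dvd int q * \<kappa> r \<one>" if "r \<in> R" "(\<Sum>y\<in>R. \<kappa> r y) = 0" for r
  proof -
    have "int p dvd (\<Sum>y\<in>R. \<kappa> r y - \<kappa> r \<one>)" using dvd that(1) by (intro dvd_sum) auto
    also have "(\<Sum>y\<in>R. \<kappa> r y - \<kappa> r \<one>) = - (int q * \<kappa> r \<one>)"
      using that(2) R(2) by (simp add: sum_subtractf)
    finally show ?thesis by simp
  qed
  have pq: "\<not> int p dvd int q"
    using p R(3) primes_dvd_imp_eq by auto
  have prime_p: "Factorial_Ring.prime (int p)" using p by simp
  show False
  proof (cases "x \<in> R")
    case False
    have "R \<noteq> {\<one>}" using R(2,3) by auto
    then obtain r where r: "r \<in> R" "r \<noteq> \<one>" using one by blast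
    have rc: "r \<in> carrier G" using r subgroup.mem_carrier[OF R(1)] by blast
    have rx: "r \<otimes> x \<notin> R"
    proof
      assume "r \<otimes> x \<in> R"
      then have "inv r \<otimes> (r \<otimes> x) \<in> R"
        using r R(1) by (simp add: subgroup.m_closed subgroup.m_inv_closed)
      then show False using False rc x by (simp add: inv_mult_cancel)
    qed
    \<comment> \<open>Both \<open>x\<close> and \<open>r \<otimes> x\<close> lie outside
      \<open>R\<close>, so on \<open>R\<close> only the part 1 - r of the group ring element is
      seen. Its coefficients sum to 0, but the one at \<open>\<one>\<close> is 1.\<close>
    have k: "\<kappa> r y = (if y = \<one> then 1 else 0) - (if y = r then 1 else 0)" if "y \<in> R" for y
      using that False rx by (auto simp: \<kappa>_def)
    then have "(\<Sum>y\<in>R. \<kappa> r y) = (\<Sum>y\<in>R. (if y = \<one> then 1 else 0) - (if y = r then 1 else 0))"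
      by (intro sum.cong) auto
    also have "\<dots> = 0" using fin one r by (simp add: sum_subtractf)
    finally have "int p dvd int q * \<kappa> r \<one>" using sum_dvd r by blast
    then show False using k[OF one] r pq by simp
  next
    case True
    let ?r = "inv x"
    have r: "?r \<in> R" using True R(1) by (simp add: subgroup.m_inv_closed)
    have rx: "?r \<otimes> x = \<one>" "?r \<noteq> \<one>" using x by auto
    \<comment> \<open>For r = x^-1 the product (1 - r)(1 - x) is 2 - x - x^-1.\<close>
    have k: "\<kappa> ?r y = 2 * (if y = \<one> then 1 else 0) - (if y = x then 1 else 0) - (if y = ?r then 1 else 0)" for y
      by (auto simp: \<kappa>_def rx)
    then have "(\<Sum>y\<in>R. \<kappa> ?r y) = 0"
      using fin one r True by (simp add: sum_subtractf sum_distrib_left[symmetric] k)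
    then have "int p dvd int q * \<kappa> ?r \<one>" using sum_dvd r by blast
    moreover have k1: "\<kappa> ?r \<one> = 2" using x(2) rx(2) by (simp add: k eq_commute[of \<one>])
    ultimately have "int p dvd 2" using pq prime_dvd_multD[OF prime_p, of "int q" 2] by (simp only: k1) blast
    \<comment> \<open>Only p = 2 survives the coefficient 2 at \<open>\<one>\<close>. Then q is odd,
      so \<open>x\<close> is not an involution and has coefficient -1, which differs from 2 by an
      odd number.\<close>
    then have p2: "p = 2"
      using p(1) by (metis int_dvd_int_iff int_ops(3) primes_dvd_imp_eq two_is_prime_nat)
    have "x \<noteq> ?r"
    proof
      assume "x = ?r"
      then have "x \<otimes> x = \<one>" using x by (metis r_inv)
      then have "x [^] (2::nat) = \<one>" using x by (simp add: numeral_2_eq_2)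
      then have "ord x dvd 2" using pow_eq_id[OF x(1)] by simp
      moreover have "x [^] q = \<one>"
        using group.pow_order_eq_1[OF subgroup_imp_group[OF R(1)], of x] True R(2)
        by (simp add: order_def nat_pow_def)
      then have "ord x dvd q" using pow_eq_id[OF x(1)] by simp
      moreover have "coprime q 2" using p2 p(2) R(3) primes_coprime two_is_prime_nat by blast
      ultimately have "ord x = 1" using coprime_common_divisor_nat[of q 2] by (metis coprime_common_divisor nat_dvd_1_iff_1)
      then show False using ord_eq_1[OF x(1)] x(2) by simp
    qed
    then have "\<kappa> ?r x = -1" using x by (simp add: k)
    then have "int 2 dvd -1 - 2" using dvd[OF r True] k1 p2 by simp
    then show False by simp
  qed
qed

section \<open>The subgroup D of the quotient: faithfulness and invariance\<close>

context wreath_quotient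
begin

lemma mult_inv_eq_iff: "y \<in> H \<Longrightarrow> g \<in> H \<Longrightarrow> h \<in> H \<Longrightarrow> y \<otimes> inv g = h \<longleftrightarrow> y = h \<otimes> g"
  by (auto simp: m_assoc H_carrier)

text \<open>This is b^-1 b^r for the coset \<open>b\<close> of the function with single entry
  \<open>u\<close> at \<open>\<one>\<close>; in the group ring, r - 1.\<close>

lemma D_sub_generator:
  assumes u: "u \<in> carrier M" and r: "r \<in> R" and RH: "R \<subseteq> H"
  shows "cl (E u (\<lambda>y. ind r y - ind \<one> y)) \<in> D_sub G H R M"
proof -
  have one: "\<one> \<in> H" by (rule subgroup.one_closed[OF H(1)])
  have rH: "r \<in> H" using r RH by auto
  let ?b = "cl (E u (ind \<one>))"
  have b: "?b \<in> carrier Q" using u E_closed by simp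
  have "coset_act G H r ?b = cl (E u (ind r))"
    using coset_act_cl[OF rH] u E_closed E_shift_ind[OF rH one] H_carrier[OF rH] by simp
  then have "inv\<^bsub>Q\<^esub> ?b \<otimes>\<^bsub>Q\<^esub> coset_act G H r ?b = cl (inv\<^bsub>B\<^esub> E u (ind \<one>) \<otimes>\<^bsub>B\<^esub> E u (ind r))"
    using u E_closed by simp
  also have "inv\<^bsub>B\<^esub> E u (ind \<one>) \<otimes>\<^bsub>B\<^esub> E u (ind r) = E u (\<lambda>y. ind r y - ind \<one> y)"
    using u by (simp add: E_minus E_add)
  finally have "cl (E u (\<lambda>y. ind r y - ind \<one> y)) = inv\<^bsub>Q\<^esub> ?b \<otimes>\<^bsub>Q\<^esub> coset_act G H r ?b" by simp
  then show ?thesis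
    unfolding D_sub_def act_comm_def using b r by (intro generate.incl) force
qed

text \<open>Take \<open>d\<close> from \<open>u\<close> and r - 1, and \<open>e\<close> from
  \<open>v\<close> and s - 1. Then [d, x] has the coefficients of (r - 1)(x - 1), and pairing with s
  - 1 gives the difference of the coefficients at s and \<open>\<one>\<close>. By
  \<open>indicator_difference_mod\<close> r and s can be chosen so that p does not divide
  it.\<close>

lemma D_sub_faithful:
  assumes R: "subgroup R G" "R \<subseteq> H" "card R = q" "Factorial_Ring.prime q" "p \<noteq> q"
    and x: "x \<in> H" "x \<noteq> \<one>"
  shows "\<exists>d\<in>D_sub G H R M. \<exists>e\<in>D_sub G H R M.
    inv\<^bsub>Q\<^esub> d \<otimes>\<^bsub>Q\<^esub> coset_act G H x d \<otimes>\<^bsub>Q\<^esub> e \<noteq> e \<otimes>\<^bsub>Q\<^esub> (inv\<^bsub>Q\<^esub> d \<otimes>\<^bsub>Q\<^esub> coset_act G H x d)"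
proof -
  obtain u v where uv: "u \<in> carrier M" "v \<in> carrier M"
    "u \<otimes>\<^bsub>M\<^esub> v \<otimes>\<^bsub>M\<^esub> inv\<^bsub>M\<^esub> u \<otimes>\<^bsub>M\<^esub> inv\<^bsub>M\<^esub> v \<noteq> \<one>\<^bsub>M\<^esub>" by (rule ex_commutator_nontrivial)
  have one: "\<one> \<in> H" by (rule subgroup.one_closed[OF H(1)])
  obtain r s where rs: "r \<in> R" "s \<in> R"
    and ndvd: "\<not> int p dvd ind (r \<otimes> x) s - ind x s - (ind r s - ind \<one> s)
      - (ind (r \<otimes> x) \<one> - ind x \<one> - (ind r \<one> - ind \<one> \<one>))"
    using indicator_difference_mod[OF R(1,3,4) p R(5) H_carrier[OF x(1)] x(2)] by blast
  have rH: "r \<in> H" "s \<in> H" using rs R(2) by auto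
  let ?k = "\<lambda>y. ind (r \<otimes> x) y - ind x y - (ind r y - ind \<one> y)"
  let ?l = "\<lambda>y. ind s y - ind \<one> y"
  let ?d = "cl (E u (\<lambda>y. ind r y - ind \<one> y))" and ?e = "cl (E v ?l)"
  have "reg_act G H x (E u (\<lambda>y. ind r y - ind \<one> y)) = E u (\<lambda>y. ind (r \<otimes> x) y - ind x y)"
    unfolding E_shift[OF x(1)]
    using x rH one H_carrier by (intro E_cong) (simp add: mult_inv_eq_iff)
  then have "coset_act G H x ?d = cl (E u (\<lambda>y. ind (r \<otimes> x) y - ind x y))"
    using coset_act_cl[OF x(1)] uv E_closed by simp
  then have "inv\<^bsub>Q\<^esub> ?d \<otimes>\<^bsub>Q\<^esub> coset_act G H x ?d =
      cl (inv\<^bsub>B\<^esub> E u (\<lambda>y. ind r y - ind \<one> y) \<otimes>\<^bsub>B\<^esub> E u (\<lambda>y. ind (r \<otimes> x) y - ind x y))"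
    using uv E_closed by simp
  also have "inv\<^bsub>B\<^esub> E u (\<lambda>y. ind r y - ind \<one> y) \<otimes>\<^bsub>B\<^esub> E u (\<lambda>y. ind (r \<otimes> x) y - ind x y) = E u ?k"
    using uv by (simp add: E_minus E_add) (intro E_cong, simp)
  finally have c: "inv\<^bsub>Q\<^esub> ?d \<otimes>\<^bsub>Q\<^esub> coset_act G H x ?d = cl (E u ?k)" .
  have "(\<Sum>y\<in>H. ?k y * ?l y) = (\<Sum>y\<in>H. (if y = s then ?k y else 0) - (if y = \<one> then ?k y else 0))"
    by (intro sum.cong) auto
  also have "\<dots> = ?k s - ?k \<one>"
    unfolding sum_subtractf using H(2) rH one by (simp add: sum.delta)
  finally have sum_eq: "(\<Sum>y\<in>H. ?k y * ?l y) = ?k s - ?k \<one>" .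
  have "\<not> int p dvd (\<Sum>y\<in>H. ?k y * ?l y)" unfolding sum_eq by (rule ndvd)
  then have "cl (E u ?k) \<otimes>\<^bsub>Q\<^esub> ?e \<noteq> ?e \<otimes>\<^bsub>Q\<^esub> cl (E u ?k)"
    using cl_E_commute_imp[OF uv] by blast
  then show ?thesis
    unfolding c[symmetric] using D_sub_generator[OF uv(1) rs(1) R(2)] D_sub_generator[OF uv(2) rs(2) R(2)] by blast
qed

lemma D_sub_coprime_action:
  assumes R: "subgroup R G" "R \<subseteq> H" "card R = q" "Factorial_Ring.prime q" "p \<noteq> q"
    and n: "card (carrier M) = p ^ n"
  shows "coprime_action Q G R (coset_act G H) p q n Zbar"
proof -
  have RH: "g \<in> H" if "g \<in> R" for g using that R(2) by blast
  show ?thesis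
    by (intro coprime_action.intro coprime_action_axioms.intro cl.H.is_group is_group;
        (rule Zbar_central; assumption)?)
      (use R p in \<open>auto simp: RH coset_act_mult coset_act_one Zbar_subgroup card_Zbar
        Q_exponent[OF n] intro: coset_act_hom Q_commutator\<close>)
qed

text \<open>The image of b^-1 b^r under \<open>g\<close> is c^-1 c^t with c = b^g and t = g^-1 r g.
  As \<open>H\<close> normalises \<open>R\<close>, the action maps generators to generators.\<close>

lemma D_sub_invariant:
  assumes R: "subgroup R G" "R \<subseteq> H" "normalised_by R H"
    and g: "g \<in> H" and d: "d \<in> D_sub G H R M"
  shows "coset_act G H g d \<in> D_sub G H R M"
proof -
  let ?S = "(\<lambda>(a, b). inv\<^bsub>Q\<^esub> a \<otimes>\<^bsub>Q\<^esub> coset_act G H b a) ` (carrier Q \<times> R)"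
  interpret a: group_hom Q Q "coset_act G H g" by unfold_locales (rule coset_act_hom[OF g])
  have S: "?S \<subseteq> carrier Q" using R(2) coset_act_closed by auto
  have "coset_act G H g ` ?S \<subseteq> ?S"
  proof clarify
    fix b r assume b: "b \<in> carrier Q" and r: "r \<in> R"
    have rH: "r \<in> H" using r R(2) by auto
    have r': "inv g \<otimes> r \<otimes> g \<in> R" using normalised_byD[OF R(3) r g] .
    have "coset_act G H (inv g \<otimes> r \<otimes> g) (coset_act G H g b) = coset_act G H (g \<otimes> (inv g \<otimes> r \<otimes> g)) b"
      using r' R(2) g b by (intro coset_act_mult[symmetric]) auto
    also have "g \<otimes> (inv g \<otimes> r \<otimes> g) = r \<otimes> g"
      using g rH H_carrier by (simp add: m_assoc inv_mult_cancel)
    also have "coset_act G H (r \<otimes> g) b = coset_act G H g (coset_act G H r b)"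
      using rH g b by (rule coset_act_mult)
    finally have "coset_act G H g (inv\<^bsub>Q\<^esub> b \<otimes>\<^bsub>Q\<^esub> coset_act G H r b) =
        inv\<^bsub>Q\<^esub> (coset_act G H g b) \<otimes>\<^bsub>Q\<^esub> coset_act G H (inv g \<otimes> r \<otimes> g) (coset_act G H g b)"
      using b rH coset_act_closed by simp
    then show "coset_act G H g (inv\<^bsub>Q\<^esub> b \<otimes>\<^bsub>Q\<^esub> coset_act G H r b) \<in> ?S"
      using b r' coset_act_closed[OF g b] by force
  qed
  then have "generate Q (coset_act G H g ` ?S) \<subseteq> generate Q ?S" by (rule cl.H.mono_generate)
  then show ?thesis
    using d a.generate_img[OF S] unfolding D_sub_def act_comm_def by blast
qed

end

lemma (in group) normalised_by_set_mult:
  assumes N: "N \<subseteq> carrier G" "D \<subseteq> carrier G" "H \<subseteq> carrier G"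
    and n: "normalised_by N D" "normalised_by N H"
  shows "normalised_by N (D <#> H)"
  unfolding normalised_by_def
proof (intro ballI)
  fix x g assume x: "x \<in> N" and "g \<in> D <#> H"
  then obtain d h where g: "d \<in> D" "h \<in> H" "g = d \<otimes> h" by (auto simp: set_mult_def)
  have "inv h \<otimes> (inv d \<otimes> x \<otimes> d) \<otimes> h \<in> N"
    using normalised_byD[OF n(2) normalised_byD[OF n(1) x g(1)] g(2)] .
  then show "inv g \<otimes> x \<otimes> g \<in> N"
    using g N x by (simp add: subset_iff m_assoc inv_mult_group)
qed

section \<open>One semidirect product step inside the ambient group\<close>

locale wreath_step = wreath_quotient G M H p
  for G :: "('a, 'b) monoid_scheme" (structure) and M :: "('m, 'c) monoid_scheme" and H p +
  fixes R D :: "'a set" and q :: nat and \<theta> :: "('a \<Rightarrow> 'm) set \<Rightarrow> 'a"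
  assumes R: "subgroup R G" "R \<subseteq> H" "card R = q" "Factorial_Ring.prime q" "p \<noteq> q"
    and R_normalised: "normalised_by R H"
    and theta: "\<theta> \<in> iso (Q\<lparr>carrier := D_sub G H R M\<rparr>) (G\<lparr>carrier := D\<rparr>)"
    and theta_act: "\<And>d g. d \<in> D_sub G H R M \<Longrightarrow> g \<in> H \<Longrightarrow>
      \<theta> (coset_act G H g d) = inv g \<otimes> \<theta> d \<otimes> g"
    and DH: "D \<inter> H = {\<one>}" "D <#> H \<subseteq> carrier G"
begin

text \<open>\<open>extraspecial\<close> only asserts that such an exponent exists, whereas the
  sublocale \<open>ca\<close> takes a definite one as parameter.\<close>

definition "n = (SOME n. card (carrier M) = p ^ n)"

lemma n: "card (carrier M) = p ^ n"
proof -
  have "\<exists>n. card (carrier M) = p ^ n" using M by (simp add: extraspecial_def)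
  then show ?thesis unfolding n_def by (rule someI_ex)
qed

sublocale ca: coprime_action Q G R "coset_act G H" p q n Zbar
  by (rule D_sub_coprime_action[OF R n])

abbreviation "DQ \<equiv> D_sub G H R M"

lemma ca_D: "ca.D = DQ"
  by (simp add: ca.D_def D_sub_def)

lemma DQ_subgroup: "subgroup DQ Q"
  using ca.D_subgroup by (simp add: ca_D)

lemma DQ_carrier: "d \<in> DQ \<Longrightarrow> d \<in> carrier Q"
  using subgroup.mem_carrier[OF DQ_subgroup] .

lemma theta_mult: "a \<in> DQ \<Longrightarrow> b \<in> DQ \<Longrightarrow> \<theta> (a \<otimes>\<^bsub>Q\<^esub> b) = \<theta> a \<otimes> \<theta> b"
  using theta by (simp add: iso_def hom_def)

lemma theta_bij: "bij_betw \<theta> DQ D"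
  using theta by (simp add: iso_def)

lemma theta_image: "\<theta> ` DQ = D" and theta_inj: "inj_on \<theta> DQ"
  using theta_bij by (auto simp: bij_betw_def)

text \<open>A group isomorphism onto \<open>D\<close> does not say that \<open>D\<close> lies in the carrier of \<open>G\<close>; this has to
  be extracted from \<open>D <#> H \<subseteq> carrier G\<close>, where \<open>d = \<theta> (y \<otimes> \<one>) = d \<otimes> \<one>\<close> once \<open>\<theta> \<one> = \<one>\<close>.\<close>

lemma theta_one: "\<theta> \<one>\<^bsub>Q\<^esub> = \<one>"
proof -
  have "\<one> \<in> D" using DH(1) by blast
  then obtain z where z: "z \<in> DQ" "\<theta> z = \<one>" using theta_image by force
  \<comment> \<open>So far \<open>\<theta>\<close> is only known to be multiplicative, so just
    positive powers of \<open>z\<close> can be followed. They all go to \<open>\<one>\<close>, and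
    the one with exponent p^n is the identity of \<open>Q\<close>.\<close>
  have pow: "z [^]\<^bsub>Q\<^esub> Suc j \<in> DQ \<and> \<theta> (z [^]\<^bsub>Q\<^esub> Suc j) = \<one>" for j
  proof (induction j)
    case (Suc j)
    have eq: "z [^]\<^bsub>Q\<^esub> Suc (Suc j) = z [^]\<^bsub>Q\<^esub> Suc j \<otimes>\<^bsub>Q\<^esub> z"
      by (rule cl.H.nat_pow_Suc)
    show ?case
      unfolding eq using Suc z subgroup.m_closed[OF DQ_subgroup] theta_mult by simp
  qed (use z DQ_carrier in simp)
  obtain j where "p ^ n = Suc j"
    using prime_gt_0_nat[OF p] by (metis gr0_implies_Suc zero_less_power)
  then have "z [^]\<^bsub>Q\<^esub> Suc j = \<one>\<^bsub>Q\<^esub>"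
    using Q_exponent[OF n DQ_carrier[OF z(1)]] by simp
  then show ?thesis using pow[of j] by simp
qed

lemma D_carrier: "D \<subseteq> carrier G"
proof
  fix d assume d: "d \<in> D"
  then obtain y where y: "y \<in> DQ" "d = \<theta> y" using theta_image by blast
  have "d = \<theta> (y \<otimes>\<^bsub>Q\<^esub> \<one>\<^bsub>Q\<^esub>)" using y DQ_carrier by simp
  also have "\<dots> = d \<otimes> \<one>"
    using y theta_mult[OF y(1) subgroup.one_closed[OF DQ_subgroup]] theta_one by simp
  also have "\<dots> \<in> D <#> H"
    using d subgroup.one_closed[OF H(1)] by (auto simp: set_mult_def)
  finally show "d \<in> carrier G" using DH(2) by blast
qed

lemma theta_in_carrier: "a \<in> DQ \<Longrightarrow> \<theta> a \<in> carrier G"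
  using theta_image D_carrier by blast

sublocale theta: group_hom "Q\<lparr>carrier := DQ\<rparr>" G \<theta>
  using cl.H.subgroup_imp_group[OF DQ_subgroup] is_group theta_mult theta_in_carrier
  by (auto simp: group_hom_def group_hom_axioms_def intro!: homI)

lemma theta_inv: "a \<in> DQ \<Longrightarrow> \<theta> (inv\<^bsub>Q\<^esub> a) = inv (\<theta> a)"
  using theta.hom_inv[of a] cl.H.m_inv_consistent[OF DQ_subgroup, of a] by simp

lemma D_subgroup: "subgroup D G"
  using theta.img_is_subgroup theta_image by simp

lemma D_finite: "finite D"
proof -
  have "finite (carrier B)"
    using M H(2) by (auto simp: B_carrier extraspecial_def intro!: finite_PiE)
  then have "finite (carrier Q)" by (simp add: carrier_Q)
  then have "finite DQ" using DQ_carrier by (meson finite_subset subsetI)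
  then show ?thesis using theta_image by auto
qed

lemma act_DQ: "g \<in> H \<Longrightarrow> d \<in> DQ \<Longrightarrow> coset_act G H g d \<in> DQ"
  using D_sub_invariant[OF R(1,2) R_normalised] .

lemma D_normalised: "normalised_by D H"
  unfolding normalised_by_def
proof (intro ballI)
  fix x g assume "x \<in> D" and g: "g \<in> H"
  then obtain y where y: "y \<in> DQ" "x = \<theta> y" using theta_image by blast
  then have "inv g \<otimes> x \<otimes> g = \<theta> (coset_act G H g y)" using theta_act g by simp
  then show "inv g \<otimes> x \<otimes> g \<in> D" using act_DQ[OF g y(1)] theta_image by blast
qed

lemma theta_commutator:
  "d \<in> DQ \<Longrightarrow> g \<in> H \<Longrightarrow> \<theta> (inv\<^bsub>Q\<^esub> d \<otimes>\<^bsub>Q\<^esub> coset_act G H g d) = inv (\<theta> d) \<otimes> (inv g \<otimes> \<theta> d \<otimes> g)"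
  using act_DQ[of g d] subgroup.m_inv_closed[OF DQ_subgroup, of d]
  by (simp add: theta_mult theta_inv theta_act)

lemma DQ_commutator: "d \<in> DQ \<Longrightarrow> g \<in> H \<Longrightarrow> inv\<^bsub>Q\<^esub> d \<otimes>\<^bsub>Q\<^esub> coset_act G H g d \<in> DQ"
  using act_DQ[of g d] subgroup.m_inv_closed[OF DQ_subgroup, of d] subgroup.m_closed[OF DQ_subgroup]
  by blast

lemma D_faithful:
  assumes x: "x \<in> H" "x \<noteq> \<one>"
  shows "\<exists>d\<in>D. \<exists>e\<in>D. inv d \<otimes> (inv x \<otimes> d \<otimes> x) \<otimes> e \<noteq> e \<otimes> (inv d \<otimes> (inv x \<otimes> d \<otimes> x))"
proof -
  obtain d e where de: "d \<in> DQ" "e \<in> DQ" and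
    ne: "inv\<^bsub>Q\<^esub> d \<otimes>\<^bsub>Q\<^esub> coset_act G H x d \<otimes>\<^bsub>Q\<^esub> e \<noteq> e \<otimes>\<^bsub>Q\<^esub> (inv\<^bsub>Q\<^esub> d \<otimes>\<^bsub>Q\<^esub> coset_act G H x d)"
    using D_sub_faithful[OF R x] by blast
  let ?c = "inv\<^bsub>Q\<^esub> d \<otimes>\<^bsub>Q\<^esub> coset_act G H x d"
  have c: "?c \<in> DQ" by (rule DQ_commutator[OF de(1) x(1)])
  have "\<theta> (?c \<otimes>\<^bsub>Q\<^esub> e) \<noteq> \<theta> (e \<otimes>\<^bsub>Q\<^esub> ?c)"
    using ne inj_onD[OF theta_inj] subgroup.m_closed[OF DQ_subgroup] c de by blast
  then have "\<theta> ?c \<otimes> \<theta> e \<noteq> \<theta> e \<otimes> \<theta> ?c" using theta_mult[OF c de(2)] theta_mult[OF de(2) c] by simp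
  then show ?thesis
    using de theta_image by (auto simp: theta_commutator x)
qed

text \<open>Provides the non-commuting pair that \<open>derived_D\<close> and
  \<open>D_subset_DR\<close> ask for; faithfulness is applied to any nontrivial element of
  \<open>R\<close>.\<close>

lemma DQ_noncommuting:
  obtains d e where "d \<in> ca.D" "e \<in> ca.D" "d \<otimes>\<^bsub>Q\<^esub> e \<noteq> e \<otimes>\<^bsub>Q\<^esub> d"
proof -
  have "R \<noteq> {\<one>}" using R(3,4) by auto
  then obtain x where "x \<in> R" "x \<noteq> \<one>" using subgroup.one_closed[OF R(1)] by blast
  then have x: "x \<in> H" "x \<noteq> \<one>" using R(2) by auto
  show thesis
    using D_sub_faithful[OF R x] DQ_commutator[OF _ x(1)] that unfolding ca_D by blast
qed

lemma theta_Zbar: "Zbar \<subseteq> DQ" "derived G D = \<theta> ` Zbar"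
proof -
  have Z: "derived Q DQ = Zbar"
    using DQ_noncommuting ca.derived_D unfolding ca_D by blast
  then show "Zbar \<subseteq> DQ"
    using cl.H.derived_incl[OF _ DQ_subgroup] by blast
  have "derived (Q\<lparr>carrier := DQ\<rparr>) DQ = Zbar"
    using cl.H.derived_consistent[OF _ DQ_subgroup, of DQ] Z by simp
  then show "derived G D = \<theta> ` Zbar"
    using theta.derived_img[of DQ] theta_image by simp
qed

lemma card_derived: "card (derived G D) = p"
  using theta_Zbar card_Zbar card_image[OF inj_on_subset[OF theta_inj theta_Zbar(1)]] by simp

lemma derived_central:
  assumes "z \<in> derived G D" "d \<in> D" shows "z \<otimes> d = d \<otimes> z"
proof -
  obtain a b where *: "a \<in> Zbar" "b \<in> DQ" "z = \<theta> a" "d = \<theta> b"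
    using assms theta_Zbar(2) theta_image by blast
  have "a \<otimes>\<^bsub>Q\<^esub> b = b \<otimes>\<^bsub>Q\<^esub> a" using * DQ_carrier by (intro Zbar_central)
  then show ?thesis using * theta_Zbar(1) theta_mult[of a b] theta_mult[of b a] by auto
qed

text \<open>The equation D = [D, R] carried over by \<open>\<theta>\<close>, with conjugation in
  place of the regular action. Unlike D = [B, R] it speaks of elements of the ambient group
  only.\<close>

lemma D_generated:
  "D \<subseteq> generate G ((\<lambda>(d, r). inv d \<otimes> (inv r \<otimes> d \<otimes> r)) ` (D \<times> R))"
proof -
  let ?S = "(\<lambda>(a, b). inv\<^bsub>Q\<^esub> a \<otimes>\<^bsub>Q\<^esub> coset_act G H b a) ` (DQ \<times> R)"
  let ?T = "(\<lambda>(d, r). inv d \<otimes> (inv r \<otimes> d \<otimes> r)) ` (D \<times> R)"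
  have S: "?S \<subseteq> DQ" using DQ_commutator R(2) by auto
  have "DQ \<subseteq> generate Q ?S"
    using DQ_noncommuting ca.D_subset_DR unfolding ca_D act_comm_def by blast
  also have "\<dots> = generate (Q\<lparr>carrier := DQ\<rparr>) ?S"
    using cl.H.generate_consistent[OF S DQ_subgroup] by simp
  finally have "D \<subseteq> \<theta> ` generate (Q\<lparr>carrier := DQ\<rparr>) ?S" using theta_image by blast
  also have "\<dots> = generate G (\<theta> ` ?S)"
    using theta.generate_img[of ?S] S by simp
  also have "\<dots> \<subseteq> generate G ?T"
  proof (rule mono_generate, clarify)
    fix d r assume *: "d \<in> DQ" "r \<in> R"
    then have "\<theta> (inv\<^bsub>Q\<^esub> d \<otimes>\<^bsub>Q\<^esub> coset_act G H r d) = inv (\<theta> d) \<otimes> (inv r \<otimes> \<theta> d \<otimes> r)"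
      using theta_commutator R(2) by blast
    moreover have "\<theta> d \<in> D" using * theta_image by blast
    ultimately show "\<theta> (inv\<^bsub>Q\<^esub> d \<otimes>\<^bsub>Q\<^esub> coset_act G H r d) \<in> ?T" using * by force
  qed
  finally show ?thesis .
qed

end

section \<open>Towers of semidirect products\<close>

text \<open>From here on the wreath products are hidden behind these properties. \<open>Ds 0\<close>
  is left unspecified, so every condition on \<open>Ds\<close> is stated at a successor.\<close>

locale group_tower = group G for G (structure) +
  fixes Gs Ds Rs :: "nat \<Rightarrow> 'a set"
  assumes Gs_0: "subgroup (Gs 0) G" "finite (Gs 0)" "comm_group (G\<lparr>carrier := Gs 0\<rparr>)"
    and Gs_Suc: "\<And>i. Gs (Suc i) = Ds (Suc i) <#> Gs i"
    and Ds_Int: "\<And>i. Ds (Suc i) \<inter> Gs i = {\<one>}"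
    and Ds_subgroup: "\<And>i. subgroup (Ds (Suc i)) G"
    and Ds_finite: "\<And>i. finite (Ds (Suc i))"
    and Ds_normalised: "\<And>i. normalised_by (Ds (Suc i)) (Gs i)"
    and Rs_Suc: "\<And>i. Rs (Suc i) = derived G (Ds (Suc i))"
    and Rs_prime: "\<And>i. Factorial_Ring.prime (card (Rs (Suc i)))"
    and Rs_central: "\<And>i z d. z \<in> Rs (Suc i) \<Longrightarrow> d \<in> Ds (Suc i) \<Longrightarrow> z \<otimes> d = d \<otimes> z"
    and Ds_generated: "\<And>i. Ds (Suc i) \<subseteq>
      generate G ((\<lambda>(d, r). inv d \<otimes> (inv r \<otimes> d \<otimes> r)) ` (Ds (Suc i) \<times> Rs i))"
    and Ds_faithful: "\<And>i x. x \<in> Gs i \<Longrightarrow> x \<noteq> \<one> \<Longrightarrow>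
      \<exists>d\<in>Ds (Suc i). \<exists>e\<in>Ds (Suc i).
        inv d \<otimes> (inv x \<otimes> d \<otimes> x) \<otimes> e \<noteq> e \<otimes> (inv d \<otimes> (inv x \<otimes> d \<otimes> x))"
    and Union_Gs: "(\<Union>i. Gs i) = carrier G"
begin

lemma Gs_subgroup_finite: "subgroup (Gs i) G \<and> finite (Gs i)"
proof (induction i)
  case 0
  then show ?case using Gs_0 by simp
next
  case (Suc i)
  have "finite (Ds (Suc i) <#> Gs i)"
    using Suc Ds_finite[of i] by (auto simp: set_mult_def)
  then show ?case
    using Suc subgroup_set_mult_normalised[OF Ds_subgroup _ Ds_normalised] by (simp add: Gs_Suc)
qed

lemma Gs_subgroup: "subgroup (Gs i) G" and Gs_finite: "finite (Gs i)"
  using Gs_subgroup_finite by auto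

lemma Gs_mono: "i \<le> j \<Longrightarrow> Gs i \<subseteq> Gs j"
  by (rule lift_Suc_mono_le) (use subset_set_mult(2)[OF Ds_subgroup Gs_subgroup] Gs_Suc in auto)

lemma Ds_carrier: "Ds (Suc i) \<subseteq> carrier G"
  by (rule subgroup.subset[OF Ds_subgroup])

lemma Gs_carrier: "Gs i \<subseteq> carrier G"
  by (rule subgroup.subset[OF Gs_subgroup])

lemma Ds_in_carrier: "x \<in> Ds (Suc i) \<Longrightarrow> x \<in> carrier G"
  and Gs_in_carrier: "x \<in> Gs i \<Longrightarrow> x \<in> carrier G"
  using Ds_carrier Gs_carrier by blast+

lemma in_Gs: "x \<in> carrier G \<Longrightarrow> \<exists>i\<ge>n. x \<in> Gs i"
  using Union_Gs Gs_mono by (metis UN_E le_cases subsetD order_refl)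

lemma Rs_subset_Ds: "Rs (Suc i) \<subseteq> Ds (Suc i)"
  unfolding Rs_Suc by (rule derived_incl[OF _ Ds_subgroup]) simp

lemma Rs_subgroup: "subgroup (Rs (Suc i)) G"
  unfolding Rs_Suc by (rule derived_is_subgroup[OF Ds_carrier])

lemma Ds_nontrivial: "\<exists>x\<in>Ds (Suc i). x \<noteq> \<one>"
proof (rule ccontr)
  assume "\<not> ?thesis"
  then have "Rs (Suc i) = {\<one>}"
    using Rs_subset_Ds[of i] subgroup.one_closed[OF Rs_subgroup[of i]] by auto
  then show False using Rs_prime[of i] by simp
qed

section \<open>Subgroups normalised by almost all factors\<close>

lemma derived_subset_normalised:
  assumes N: "subgroup N G" "normalised_by N (Ds (Suc i))"
    and x: "x \<in> N" "x \<in> Gs i" "x \<noteq> \<one>"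
  shows "Rs (Suc i) \<subseteq> N"
proof -
  obtain d e where de: "d \<in> Ds (Suc i)" "e \<in> Ds (Suc i)"
    and ne: "inv d \<otimes> (inv x \<otimes> d \<otimes> x) \<otimes> e \<noteq> e \<otimes> (inv d \<otimes> (inv x \<otimes> d \<otimes> x))"
    using Ds_faithful[OF x(2,3)] by blast
  \<comment> \<open>\<open>c\<close> is [d, x]: it lies in \<open>N\<close> because \<open>x\<close>
    does, and in \<open>Ds (Suc i)\<close> because \<open>d\<close> does. Hence [c, e] is a
    nontrivial element of \<open>N\<close> inside the group \<open>Rs (Suc i)\<close> of prime
    order.\<close>
  define c where "c = inv d \<otimes> (inv x \<otimes> d \<otimes> x)"
  have carr: "d \<in> carrier G" "e \<in> carrier G" "x \<in> carrier G"
    using de x Ds_carrier Gs_carrier by auto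
  then have cc: "c \<in> carrier G" by (simp add: c_def)
  have "c = (inv d \<otimes> inv x \<otimes> d) \<otimes> x" using carr by (simp add: c_def m_assoc)
  also have "\<dots> \<in> N"
    using normalised_byD[OF N(2) _ de(1)] x N(1) by (simp add: subgroup.m_closed subgroup.m_inv_closed)
  finally have cN: "c \<in> N" .
  have "inv x \<otimes> d \<otimes> x \<in> Ds (Suc i)"
    using normalised_byD[OF Ds_normalised de(1) x(2)] .
  then have cD: "c \<in> Ds (Suc i)"
    using de Ds_subgroup[of i] by (simp add: c_def subgroup.m_closed subgroup.m_inv_closed)
  define y where "y = c \<otimes> e \<otimes> inv c \<otimes> inv e"
  have yR: "y \<in> Rs (Suc i)"
    unfolding y_def Rs_Suc derived_def using cD de by (intro generate.incl) blast
  have "y = c \<otimes> (e \<otimes> inv c \<otimes> inv e)" using cc carr by (simp add: y_def m_assoc)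
  also have "\<dots> \<in> N"
    using normalised_byD'[OF N(2) Ds_subgroup _ de(2)] cN N(1)
    by (simp add: subgroup.m_closed subgroup.m_inv_closed)
  finally have yN: "y \<in> N" .
  have "y \<noteq> \<one>"
  proof
    assume "y = \<one>"
    moreover have "c \<otimes> e = y \<otimes> (e \<otimes> c)"
      using cc carr by (simp add: y_def m_assoc inv_mult_cancel)
    ultimately show False using ne cc carr by (simp add: c_def)
  qed
  then show ?thesis
    using prime_card_subset[OF Rs_subgroup Rs_prime N(1) yN yR] by blast
qed

text \<open>Regrouped as (d^-1 r^-1 d) r, each generator [d, r] of \<open>Ds (Suc i)\<close> is a
  product of two elements of \<open>N\<close>.\<close>

lemma Ds_subset_normalised:
  assumes N: "subgroup N G" "normalised_by N (Ds (Suc i))" and R: "Rs i \<subseteq> N"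
  shows "Ds (Suc i) \<subseteq> N"
proof (rule subset_trans[OF Ds_generated generate_subgroup_incl[OF _ N(1)]], clarify)
  fix d r assume *: "d \<in> Ds (Suc i)" "r \<in> Rs i"
  then have r: "r \<in> N" using R by auto
  have c: "d \<in> carrier G" "r \<in> carrier G"
    using * r Ds_carrier subgroup.mem_carrier[OF N(1)] by auto
  have "inv d \<otimes> (inv r \<otimes> d \<otimes> r) = (inv d \<otimes> inv r \<otimes> d) \<otimes> r"
    using c by (simp add: m_assoc)
  also have "\<dots> \<in> N"
    using normalised_byD[OF N(2) _ *(1)] r N(1) by (simp add: subgroup.m_closed subgroup.m_inv_closed)
  finally show "inv d \<otimes> (inv r \<otimes> d \<otimes> r) \<in> N" .
qed

text \<open>Normalisation is asked for beyond \<open>n0\<close> only, because the lemma is also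
  applied to a normal subgroup of a subgroup that contains merely the late
  \<open>Ds m\<close>.\<close>

lemma eventually_Ds_subset:
  assumes N: "subgroup N G" "\<And>m. m > n0 \<Longrightarrow> normalised_by N (Ds m)"
    and x: "x \<in> N" "x \<noteq> \<one>"
  shows "\<exists>n. \<forall>m>n. Ds m \<subseteq> N"
proof -
  \<comment> \<open>The stages increase, so \<open>x\<close> may be placed in a late one; then the
    chain starting from it meets only factors that normalise \<open>N\<close>.\<close>
  obtain i where i: "i \<ge> n0" "x \<in> Gs i"
    using in_Gs[of x n0] subgroup.mem_carrier[OF N(1) x(1)] by blast
  have R: "Rs (Suc (i + k)) \<subseteq> N \<and> Ds (Suc (Suc (i + k))) \<subseteq> N" for k
  proof (induction k)
    case 0
    have "Rs (Suc i) \<subseteq> N"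
      using derived_subset_normalised[OF N(1) N(2) x(1) i(2) x(2)] i(1) by simp
    then show ?case
      using Ds_subset_normalised[OF N(1) N(2), of "Suc i"] i(1) by simp
  next
    case (Suc k)
    then have "Rs (Suc (i + Suc k)) \<subseteq> N" using Rs_subset_Ds[of "Suc (i + k)"] by auto
    then show ?case
      using Ds_subset_normalised[OF N(1) N(2), of "Suc (i + Suc k)"] i(1) by simp
  qed
  have "Ds m \<subseteq> N" if "m > Suc i" for m
  proof -
    obtain k where "m = Suc (Suc (i + k))"
      using less_imp_Suc_add[OF \<open>m > Suc i\<close>] by auto
    then show ?thesis using R by simp
  qed
  then show ?thesis by blast
qed

text \<open>An element of a later stage has its leftmost factor in some \<open>Ds m\<close> with
  \<open>m > n\<close>. These factors are absorbed into \<open>N\<close> one by one until an element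
  of \<open>Gs n\<close> remains.\<close>

lemma factorisation:
  assumes N: "subgroup N G" "\<And>m. m > n \<Longrightarrow> Ds m \<subseteq> N" and g: "g \<in> carrier G"
  shows "\<exists>k\<in>N. \<exists>h\<in>Gs n. g = k \<otimes> h"
proof -
  have "\<forall>g\<in>Gs (n + j). \<exists>k\<in>N. \<exists>h\<in>Gs n. g = k \<otimes> h" for j
  proof (induction j)
    case 0
    have "g = \<one> \<otimes> g" if "g \<in> Gs n" for g using that Gs_in_carrier by simp
    then show ?case using subgroup.one_closed[OF N(1)] by auto
  next
    case (Suc j)
    show ?case
    proof
      fix g assume "g \<in> Gs (n + Suc j)"
      then obtain d g' where *: "d \<in> Ds (Suc (n + j))" "g' \<in> Gs (n + j)" "g = d \<otimes> g'"
        by (auto simp: Gs_Suc set_mult_def)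
      then obtain k h where kh: "k \<in> N" "h \<in> Gs n" "g' = k \<otimes> h" using Suc by blast
      have d: "d \<in> N" using * N(2)[of "Suc (n + j)"] by auto
      have "g = (d \<otimes> k) \<otimes> h"
        using * kh d subgroup.mem_carrier[OF N(1)] Gs_carrier
        by (simp add: m_assoc subset_iff)
      then show "\<exists>k\<in>N. \<exists>h\<in>Gs n. g = k \<otimes> h"
        using kh(2) subgroup.m_closed[OF N(1) d kh(1)] by blast
    qed
  qed
  moreover obtain i where "i \<ge> n" "g \<in> Gs i" using in_Gs[OF g, of n] by blast
  ultimately show ?thesis by (metis le_iff_add)
qed

lemma finite_cosets:
  assumes N: "subgroup N G" "\<And>m. m > n \<Longrightarrow> Ds m \<subseteq> N"
  shows "finite ((\<lambda>g. N #> g) ` carrier G)"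
proof (rule finite_subset)
  show "finite ((\<lambda>g. N #> g) ` Gs n)" using Gs_finite by simp
  show "(\<lambda>g. N #> g) ` carrier G \<subseteq> (\<lambda>g. N #> g) ` Gs n"
  proof clarify
    fix g assume "g \<in> carrier G"
    then obtain k h where *: "k \<in> N" "h \<in> Gs n" "g = k \<otimes> h" using factorisation[OF N] by blast
    have "N #> g = N #> k #> h"
      using * Gs_carrier subgroup.subset[OF N(1)] by (simp add: coset_mult_assoc subset_iff)
    also have "N #> k = N"
      using * subgroup.mem_carrier[OF N(1)] N(1) by (intro coset_join2) auto
    finally show "N #> g \<in> (\<lambda>g. N #> g) ` Gs n" using * by simp
  qed
qed

text \<open>A finite subset lies in some late stage \<open>Gs i\<close>, which meets the nontrivial
  group \<open>Ds (Suc i)\<close> trivially.\<close>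

lemma infinite_if_Ds_subset:
  assumes "F \<subseteq> carrier G" "\<And>m. m > n \<Longrightarrow> Ds m \<subseteq> F"
  shows "infinite F"
proof
  assume "finite F"
  then have "\<exists>i\<ge>n. F \<subseteq> Gs i" using assms(1)
  proof (induction F)
    case (insert x F)
    then obtain i where "i \<ge> n" "F \<subseteq> Gs i" by blast
    moreover obtain j where "j \<ge> i" "x \<in> Gs j" using in_Gs[of x i] insert.prems by blast
    ultimately show ?case using Gs_mono[of i j] by (intro exI[of _ j]) auto
  qed auto
  then obtain i where i: "i \<ge> n" "F \<subseteq> Gs i" by blast
  then have "Ds (Suc i) \<subseteq> Gs i" using assms(2)[of "Suc i"] by auto
  then have "Ds (Suc i) = {\<one>}" using Ds_Int[of i] by blast
  then show False using Ds_nontrivial[of i] by auto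
qed

lemma infinite_carrier: "infinite (carrier G)"
  by (rule infinite_if_Ds_subset[of _ 0]) (use Ds_carrier in \<open>auto simp: gr0_conv_Suc\<close>)

text \<open>A normal subgroup \<open>N\<close> of \<open>H\<close> is normalised by the late
  \<open>Ds m\<close>, since they lie in \<open>H\<close>; if nontrivial, it therefore contains
  almost all of them. Its cosets in \<open>H\<close> are among its finitely many cosets in the whole
  group.\<close>

lemma just_infinite_subgroup:
  assumes H: "subgroup H G" "\<And>m. m > n \<Longrightarrow> Ds m \<subseteq> H"
  shows "just_infinite (G\<lparr>carrier := H\<rparr>)"
  unfolding just_infinite_def
proof (intro conjI allI impI)
  show "group (G\<lparr>carrier := H\<rparr>)" by (rule subgroup_imp_group[OF H(1)])
  show "infinite (carrier (G\<lparr>carrier := H\<rparr>))"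
    using infinite_if_Ds_subset[OF subgroup.subset[OF H(1)] H(2)] by simp
  fix N assume *: "N \<lhd> G\<lparr>carrier := H\<rparr> \<and> N \<noteq> {\<one>\<^bsub>G\<lparr>carrier := H\<rparr>\<^esub>}"
  have N: "subgroup N G"
    using * incl_subgroup[OF H(1)] normal_imp_subgroup by blast
  have norm: "normalised_by N (Ds m)" if "m > n" for m
    using normalised_by_mono[OF normal_imp_normalised_by[OF _ H(1)] H(2)[OF that]] * by blast
  obtain x where "x \<in> N" "x \<noteq> \<one>" using * subgroup.one_closed[OF N] by auto
  then obtain k where "\<forall>m>k. Ds m \<subseteq> N"
    using eventually_Ds_subset[OF N norm] by blast
  then have "finite ((\<lambda>g. N #> g) ` carrier G)"
    using finite_cosets[OF N, of k] by blast
  moreover have "carrier (G\<lparr>carrier := H\<rparr> Mod N) \<subseteq> (\<lambda>g. N #> g) ` carrier G"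
    using subgroup.subset[OF H(1)] by (auto simp: carrier_FactGroup)
  ultimately show "finite (carrier (G\<lparr>carrier := H\<rparr> Mod N))"
    by (rule rev_finite_subset)
qed

theorem hereditarily_just_infinite: "hereditarily_just_infinite G"
  unfolding hereditarily_just_infinite_def
proof (intro conjI allI impI infinite_carrier)
  fix H assume H: "subgroup H G \<and> finite (rcosets H)"
  \<comment> \<open>\<open>H\<close> need not be normalised by any \<open>Ds m\<close>, so the
    argument first passes to a nontrivial normal subgroup inside it.\<close>
  then obtain N where N: "N \<lhd> G" "N \<subseteq> H" "N \<noteq> {\<one>}"
    using finite_index_normal_core[OF infinite_carrier] by blast
  have sub: "subgroup N G" using N(1) by (rule normal_imp_subgroup)
  have norm: "normalised_by N (Ds m)" if "m > 0" for m
    using that Ds_carrier normal.inv_op_closed1[OF N(1)]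
    by (auto simp: normalised_by_def gr0_conv_Suc)
  obtain x where "x \<in> N" "x \<noteq> \<one>" using N(3) subgroup.one_closed[OF sub] by auto
  then obtain n where "\<forall>m>n. Ds m \<subseteq> N"
    using eventually_Ds_subset[OF sub norm] by blast
  then show "just_infinite (G\<lparr>carrier := H\<rparr>)"
    using just_infinite_subgroup[of H n] H N(2) by blast
qed

section \<open>Periodicity and local solubility\<close>

theorem periodic: "periodic_group G"
  unfolding periodic_group_def
proof
  fix x assume "x \<in> carrier G"
  then obtain i where i: "x \<in> Gs i" using Union_Gs by blast
  interpret Gi: group "G\<lparr>carrier := Gs i\<rparr>" by (rule subgroup_imp_group[OF Gs_subgroup])
  have "x [^] card (Gs i) = \<one>"
    using Gi.pow_order_eq_1 i by (simp add: order_def nat_pow_def)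
  moreover have "card (Gs i) > 0"
    using Gs_finite i by (auto simp: card_gt_0_iff)
  ultimately show "\<exists>n::nat. n > 0 \<and> x [^] n = \<one>" by blast
qed

lemma derived_derived_Ds: "(derived G ^^ 2) (Ds (Suc i)) \<subseteq> {\<one>}"
proof -
  have "derived G (Rs (Suc i)) \<subseteq> {\<one>}"
    unfolding derived_def
  proof (rule generate_subgroup_incl, clarify)
    fix x y assume *: "x \<in> Rs (Suc i)" "y \<in> Rs (Suc i)"
    then have "x \<otimes> y = y \<otimes> x" using Rs_central Rs_subset_Ds by blast
    then show "x \<otimes> y \<otimes> inv x \<otimes> inv y = \<one>"
      using * subgroup.mem_carrier[OF Rs_subgroup] by (simp add: m_assoc inv_mult_cancel)
  qed (simp add: triv_subgroup)
  then show ?thesis by (simp add: numeral_2_eq_2 Rs_Suc)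
qed

text \<open>Modulo \<open>Ds (Suc i)\<close> the derived series of \<open>Gs (Suc i)\<close> follows
  that of \<open>Gs i\<close>. Once the latter is trivial, two more steps suffice, since
  \<open>Ds (Suc i)\<close> is metabelian.\<close>

lemma Gs_derived_series: "\<exists>n. (derived G ^^ n) (Gs i) \<subseteq> {\<one>}"
proof (induction i)
  case 0
  have "derived (G\<lparr>carrier := Gs 0\<rparr>) (Gs 0) = {\<one>}"
    using comm_group.derived_eq_singleton[OF Gs_0(3)] by simp
  then have "(derived G ^^ 1) (Gs 0) \<subseteq> {\<one>}"
    using derived_consistent[OF _ Gs_0(1)] by simp
  then show ?case by blast
next
  case (Suc i)
  then obtain n where n: "(derived G ^^ n) (Gs i) \<subseteq> {\<one>}" by blast
  \<comment> \<open>The second conjunct is carried along because \<open>derived_set_mult\<close>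
    needs \<open>Ds (Suc i)\<close> to be normalised by the current term of the series.\<close>
  have "(derived G ^^ k) (Gs (Suc i)) \<subseteq> Ds (Suc i) <#> (derived G ^^ k) (Gs i)
      \<and> (derived G ^^ k) (Gs i) \<subseteq> Gs i" for k
  proof (induction k)
    case 0
    then show ?case by (simp add: Gs_Suc)
  next
    case (Suc k)
    let ?H = "(derived G ^^ k) (Gs i)"
    have "normalised_by (Ds (Suc i)) ?H"
      using normalised_by_mono[OF Ds_normalised] Suc by blast
    then have "derived G (Ds (Suc i) <#> ?H) \<subseteq> Ds (Suc i) <#> derived G ?H"
      by (rule derived_set_mult[OF Ds_subgroup exp_of_derived_is_subgroup[OF Gs_subgroup]])
    moreover have "derived G ?H \<subseteq> Gs i"
      using derived_incl[OF _ Gs_subgroup] Suc by blast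
    moreover have "derived G ((derived G ^^ k) (Gs (Suc i))) \<subseteq> derived G (Ds (Suc i) <#> ?H)"
      using Suc by (intro mono_derived) blast
    ultimately show ?case by simp
  qed
  from this[of n] have "(derived G ^^ n) (Gs (Suc i)) \<subseteq> Ds (Suc i) <#> {\<one>}"
    using n mono_set_mult[of "Ds (Suc i)" "Ds (Suc i)"] by blast
  also have "\<dots> \<subseteq> Ds (Suc i)" by (auto simp: set_mult_def Ds_in_carrier)
  finally have "(derived G ^^ 2) ((derived G ^^ n) (Gs (Suc i))) \<subseteq> (derived G ^^ 2) (Ds (Suc i))"
    by (rule mono_exp_of_derived)
  then have "(derived G ^^ (2 + n)) (Gs (Suc i)) \<subseteq> {\<one>}"
    using derived_derived_Ds[of i] by (simp only: funpow_add o_apply)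
  then show ?case by blast
qed

theorem locally_soluble: "locally_soluble G"
  unfolding locally_soluble_def
proof (intro allI impI)
  fix S assume S: "finite S \<and> S \<subseteq> carrier G"
  then have "finite S" "S \<subseteq> carrier G" by auto
  then have "\<exists>i. S \<subseteq> Gs i"
  proof (induction S)
    case (insert x F)
    then obtain i where "F \<subseteq> Gs i" by blast
    moreover obtain j where "j \<ge> i" "x \<in> Gs j" using in_Gs[of x i] insert.prems by blast
    ultimately show ?case using Gs_mono[of i j] by (intro exI[of _ j]) auto
  qed auto
  then obtain i where "S \<subseteq> Gs i" by blast
  then have "generate G S \<subseteq> Gs i" by (rule generate_subgroup_incl[OF _ Gs_subgroup])
  moreover obtain n where "(derived G ^^ n) (Gs i) \<subseteq> {\<one>}" using Gs_derived_series by blast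
  ultimately have "(derived G ^^ n) (generate G S) \<subseteq> {\<one>}"
    using mono_exp_of_derived by blast
  then show "solvable (G\<lparr>carrier := generate G S\<rparr>)"
    using solvable_subgroupI[OF generate_is_subgroup] S by blast
qed

section \<open>Normal complements of the stages and residual finiteness\<close>

primrec tail :: "nat \<Rightarrow> nat \<Rightarrow> 'a set" where
  "tail n 0 = {\<one>}"
| "tail n (Suc k) = Ds (Suc (n + k)) <#> tail n k"

text \<open>\<open>tail n k\<close> is the product of \<open>Ds (n + k)\<close>, ...,
  \<open>Ds (n + 1)\<close>. For normality in the next stage write g = d h: the factor d lies in the
  new product itself, while h normalises both of its factors.\<close>

lemma tail_props:
  "subgroup (tail n k) G \<and> tail n k \<subseteq> Gs (n + k) \<and> normalised_by (tail n k) (Gs (n + k))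
    \<and> tail n k \<inter> Gs n \<subseteq> {\<one>}"
proof (induction k)
  case 0
  have "normalised_by {\<one>} (Gs n)" by (simp add: normalised_by_def Gs_in_carrier)
  then show ?case using triv_subgroup subgroup.one_closed[OF Gs_subgroup] by auto
next
  case (Suc k)
  let ?D = "Ds (Suc (n + k))" and ?T = "tail n k"
  have T: "subgroup ?T G" "?T \<subseteq> Gs (n + k)" using Suc by auto
  have nDT: "normalised_by ?D ?T"
    using normalised_by_mono[OF Ds_normalised T(2)] .
  have sub: "subgroup (?D <#> ?T) G"
    by (rule subgroup_set_mult_normalised[OF Ds_subgroup T(1) nDT])
  have incl: "?D <#> ?T \<subseteq> Gs (Suc (n + k))"
    unfolding Gs_Suc using T(2) by (intro mono_set_mult) auto
  have "normalised_by (?D <#> ?T) (Gs (Suc (n + k)))"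
    unfolding normalised_by_def
  proof (intro ballI)
    fix x g assume x: "x \<in> ?D <#> ?T" and "g \<in> Gs (Suc (n + k))"
    then obtain d h where g: "d \<in> ?D" "h \<in> Gs (n + k)" "g = d \<otimes> h"
      by (auto simp: Gs_Suc set_mult_def)
    have dh: "d \<in> carrier G" "h \<in> carrier G" using g Ds_carrier Gs_carrier by auto
    have dN: "d \<in> ?D <#> ?T" using subset_set_mult(1)[OF Ds_subgroup T(1)] g by blast
    have "inv d \<otimes> x \<otimes> d \<in> ?D <#> ?T"
      using normalised_byD[OF normalised_by_self[OF sub] x dN] .
    then obtain e t where et: "e \<in> ?D" "t \<in> ?T" "inv d \<otimes> x \<otimes> d = e \<otimes> t"
      by (auto simp: set_mult_def)
    have xc: "x \<in> carrier G" "e \<in> carrier G" "t \<in> carrier G"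
      using subgroup.mem_carrier[OF sub x] et Ds_carrier subgroup.mem_carrier[OF T(1)] by auto
    have "inv g \<otimes> x \<otimes> g = inv h \<otimes> (inv d \<otimes> x \<otimes> d) \<otimes> h"
      using g dh xc by (simp add: m_assoc inv_mult_group)
    also have "\<dots> = (inv h \<otimes> e \<otimes> h) \<otimes> (inv h \<otimes> t \<otimes> h)"
      using et dh xc by (simp add: m_assoc inv_mult_cancel)
    also have "\<dots> \<in> ?D <#> ?T"
      using normalised_byD[OF Ds_normalised et(1) g(2)] Suc normalised_byD[of ?T _ t, OF _ et(2) g(2)]
      by (auto simp: set_mult_def)
    finally show "inv g \<otimes> x \<otimes> g \<in> ?D <#> ?T" .
  qed
  moreover have "(?D <#> ?T) \<inter> Gs n \<subseteq> {\<one>}"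
  proof clarify
    fix x assume x: "x \<in> ?D <#> ?T" "x \<in> Gs n"
    then obtain d t where dt: "d \<in> ?D" "t \<in> ?T" "x = d \<otimes> t" by (auto simp: set_mult_def)
    have c: "d \<in> carrier G" "t \<in> carrier G"
      using dt Ds_carrier subgroup.mem_carrier[OF T(1)] by auto
    \<comment> \<open>Both \<open>x\<close> and \<open>t\<close> lie in the stage
      \<open>Gs (n + k)\<close>, hence so does d = x t^-1. As this stage meets
      \<open>Ds (Suc (n + k))\<close> trivially, \<open>x\<close> is the element \<open>t\<close> of
      \<open>tail n k\<close>.\<close>
    have "x \<in> Gs (n + k)" "t \<in> Gs (n + k)"
      using x dt T(2) Gs_mono[of n "n + k"] by auto
    then have "x \<otimes> inv t \<in> Gs (n + k)"
      by (intro subgroup.m_closed[OF Gs_subgroup] subgroup.m_inv_closed[OF Gs_subgroup])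
    then have "d \<in> Gs (n + k)" using dt c by (simp add: m_assoc)
    then have "d = \<one>" using dt Ds_Int[of "n + k"] by blast
    then show "x = \<one>" using dt c Suc x by auto
  qed
  ultimately show ?case using sub incl by simp
qed

lemma tail_mono: "j \<le> k \<Longrightarrow> tail n j \<subseteq> tail n k"
proof (rule lift_Suc_mono_le[of "tail n"])
  show "tail n k \<subseteq> tail n (Suc k)" for k
    using subset_set_mult(2)[OF Ds_subgroup] tail_props by auto
qed

text \<open>The normal complement of \<open>Gs n\<close>, generated by the \<open>Ds m\<close> with
  \<open>m > n\<close>. Normality passes to the increasing union because every element of the group
  lies in some \<open>Gs (n + k)\<close>.\<close>

definition "Tail n = (\<Union>k. tail n k)"

lemma Tail_common: "x \<in> Tail n \<Longrightarrow> \<exists>k\<ge>j. x \<in> tail n k"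
  unfolding Tail_def using tail_mono[of _ "max _ j" n] by (blast intro: max.cobounded1 max.cobounded2)

lemma Tail_subgroup: "subgroup (Tail n) G"
proof (rule subgroupI)
  show "Tail n \<subseteq> carrier G" using tail_props Gs_carrier by (fastforce simp: Tail_def)
  show "Tail n \<noteq> {}" unfolding Tail_def using tail.simps(1) by blast
next
  fix a assume "a \<in> Tail n"
  then show "inv a \<in> Tail n"
    using tail_props by (auto simp: Tail_def intro: subgroup.m_inv_closed)
next
  fix a b assume "a \<in> Tail n" "b \<in> Tail n"
  then obtain j where "a \<in> tail n j" by (auto simp: Tail_def)
  moreover obtain k where "k \<ge> j" "b \<in> tail n k" using Tail_common[OF \<open>b \<in> Tail n\<close>] by blast
  ultimately have "a \<otimes> b \<in> tail n k"
    using tail_props tail_mono[of j k n] by (intro subgroup.m_closed) auto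
  then show "a \<otimes> b \<in> Tail n" by (auto simp: Tail_def)
qed

lemma Tail_normal: "Tail n \<lhd> G"
proof (rule normalised_by_imp_normal[OF Tail_subgroup])
  show "normalised_by (Tail n) (carrier G)"
    unfolding normalised_by_def
  proof (intro ballI)
    fix x g assume x: "x \<in> Tail n" and g: "g \<in> carrier G"
    obtain i where "g \<in> Gs i" using g Union_Gs by blast
    moreover obtain k where "k \<ge> i" "x \<in> tail n k" using Tail_common[OF x] by blast
    ultimately have "inv g \<otimes> x \<otimes> g \<in> tail n k"
      using tail_props[of n k] Gs_mono[of i "n + k"] by (auto intro: normalised_byD)
    then show "inv g \<otimes> x \<otimes> g \<in> Tail n" by (auto simp: Tail_def)
  qed
qed

lemma Ds_subset_Tail: "m > n \<Longrightarrow> Ds m \<subseteq> Tail n"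
proof -
  assume "m > n"
  then obtain k where "m = Suc (n + k)" using less_iff_Suc_add by auto
  then have "Ds m \<subseteq> tail n (Suc k)"
    using subset_set_mult(1)[OF Ds_subgroup] tail_props by auto
  then show ?thesis unfolding Tail_def by blast
qed

theorem residually_finite: "residually_finite G"
  unfolding residually_finite_def
proof (intro ballI impI)
  fix x assume x: "x \<in> carrier G" "x \<noteq> \<one>"
  then obtain n where "x \<in> Gs n" using Union_Gs by blast
  then have "x \<notin> Tail n" using tail_props x by (auto simp: Tail_def)
  moreover have "finite (rcosets (Tail n))"
    using finite_cosets[OF Tail_subgroup Ds_subset_Tail] by (simp add: RCOSETS_def UNION_singleton_eq_range)
  ultimately show "\<exists>N. N \<lhd> G \<and> finite (rcosets N) \<and> x \<notin> N" using Tail_normal by blast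
qed

end

section \<open>The direct limit\<close>

lemma construction_limit_tower:
  assumes "construction_limit G p M Gs Ds Rs"
  shows "group_tower G Gs Ds Rs"
proof -
  note CL = assms[unfolded construction_limit_def]
  interpret group G using CL by blast
  have prime: "Factorial_Ring.prime (p i)" and pSuc: "p (Suc i) \<noteq> p i"
    and M: "extraspecial (M (Suc i)) (p (Suc i))" for i using CL by auto
  have Gs_0: "subgroup (Gs 0) G" "cyclic_group (G\<lparr>carrier := Gs 0\<rparr>)" "card (Gs 0) = p 0" "Rs 0 = Gs 0"
    using CL by auto
  have step: "Gs (Suc i) = Ds (Suc i) <#>\<^bsub>G\<^esub> Gs i" "Ds (Suc i) \<inter> Gs i = {\<one>\<^bsub>G\<^esub>}"
    "Rs (Suc i) = derived G (Ds (Suc i))" for i using CL by auto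
  have iso: "\<exists>\<theta>. \<theta> \<in> iso ((quot_base G (Gs i) (M (Suc i)))\<lparr>carrier := D_sub G (Gs i) (Rs i) (M (Suc i))\<rparr>)
        (G\<lparr>carrier := Ds (Suc i)\<rparr>) \<and>
      (\<forall>d \<in> D_sub G (Gs i) (Rs i) (M (Suc i)). \<forall>g \<in> Gs i.
        \<theta> (coset_act G (Gs i) g d) = inv\<^bsub>G\<^esub> g \<otimes>\<^bsub>G\<^esub> \<theta> d \<otimes>\<^bsub>G\<^esub> g)" for i
    using CL by blast
  have Union: "(\<Union>i. Gs i) = carrier G" using CL by blast
  have fin_0: "finite (Gs 0)" using Gs_0(3) prime[of 0] by (metis card.infinite not_prime_0)
  \<comment> \<open>The invariant of the recursion: what \<open>wreath_step\<close> demands of stage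
    \<open>i\<close>. It is established first, because all properties of \<open>Ds (Suc i)\<close>
    are drawn from that locale.\<close>
  define P where "P i \<longleftrightarrow> subgroup (Gs i) G \<and> finite (Gs i) \<and> subgroup (Rs i) G \<and> Rs i \<subseteq> Gs i
      \<and> card (Rs i) = p i \<and> normalised_by (Rs i) (Gs i)" for i
  have wreath_step: "\<exists>\<theta>. wreath_step G (M (Suc i)) (Gs i) (p (Suc i)) (Rs i) (Ds (Suc i)) (p i) \<theta>"
    if "P i" for i
  proof -
    obtain \<theta> where th: "\<theta> \<in> iso ((quot_base G (Gs i) (M (Suc i)))\<lparr>carrier := D_sub G (Gs i) (Rs i) (M (Suc i))\<rparr>)
        (G\<lparr>carrier := Ds (Suc i)\<rparr>)"
      "\<And>d g. d \<in> D_sub G (Gs i) (Rs i) (M (Suc i)) \<Longrightarrow> g \<in> Gs i \<Longrightarrow>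
        \<theta> (coset_act G (Gs i) g d) = inv\<^bsub>G\<^esub> g \<otimes>\<^bsub>G\<^esub> \<theta> d \<otimes>\<^bsub>G\<^esub> g"
      using iso[of i] by blast
    have "wreath_quotient G (M (Suc i)) (Gs i) (p (Suc i))"
      using extraspecial_class_two[OF M] that prime M is_group
      by (auto simp: wreath_quotient_def wreath_quotient_axioms_def P_def)
    \<comment> \<open>The construction places \<open>Ds (Suc i)\<close> in the carrier only
      indirectly: its product with \<open>Gs i\<close> is the next stage, and the stages exhaust the
      carrier.\<close>
    moreover have "Ds (Suc i) <#>\<^bsub>G\<^esub> Gs i \<subseteq> carrier G" using step(1)[of i] Union by blast
    ultimately have "wreath_step G (M (Suc i)) (Gs i) (p (Suc i)) (Rs i) (Ds (Suc i)) (p i) \<theta>"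
      using that th step(2)[of i] prime pSuc
      by (simp add: wreath_step_def wreath_step_axioms_def P_def)
    then show ?thesis by blast
  qed
  have P: "P i" for i
  proof (induction i)
    case 0
    then show ?case
      using Gs_0 fin_0 normalised_by_self by (simp add: P_def)
  next
    case (Suc i)
    obtain \<theta> where "wreath_step G (M (Suc i)) (Gs i) (p (Suc i)) (Rs i) (Ds (Suc i)) (p i) \<theta>"
      using wreath_step[OF Suc] by blast
    then interpret ws: wreath_step G "M (Suc i)" "Gs i" "p (Suc i)" "Rs i" "Ds (Suc i)" "p i" \<theta> .
    let ?D = "Ds (Suc i)" and ?R = "Rs (Suc i)"
    have G: "subgroup (Gs i) G" "finite (Gs i)" using Suc by (auto simp: P_def)
    have 1: "subgroup (Gs (Suc i)) G"
      unfolding step(1) by (rule subgroup_set_mult_normalised[OF ws.D_subgroup G(1) ws.D_normalised])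
    have 2: "finite (Gs (Suc i))"
      unfolding step(1) using ws.D_finite G(2) by (auto simp: set_mult_def)
    have 3: "subgroup ?R G"
      unfolding step(3) by (rule derived_is_subgroup[OF ws.D_carrier])
    have RD: "?R \<subseteq> ?D" unfolding step(3) by (rule derived_incl[OF _ ws.D_subgroup]) simp
    have 4: "?R \<subseteq> Gs (Suc i)"
      unfolding step(1) using RD subset_set_mult(1)[OF ws.D_subgroup G(1)] by blast
    \<comment> \<open>The derived subgroup of \<open>?D\<close> is normalised by whatever normalises
      \<open>?D\<close>, in particular by both factors of \<open>Gs (Suc i)\<close>.\<close>
    have 5: "normalised_by ?R (Gs (Suc i))"
      unfolding step(1) step(3) using subgroup.subset[OF G(1)] ws.D_carrier
      by (intro normalised_by_set_mult normalised_by_derived derived_in_carrier ws.D_subgroup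
          ws.D_normalised normalised_by_self)
    show ?case using 1 2 3 4 5 ws.card_derived step(3) by (simp add: P_def)
  qed
  have facts: "subgroup (Ds (Suc i)) G \<and> finite (Ds (Suc i)) \<and> normalised_by (Ds (Suc i)) (Gs i)
      \<and> card (Rs (Suc i)) = p (Suc i)
      \<and> (\<forall>z\<in>Rs (Suc i). \<forall>d\<in>Ds (Suc i). z \<otimes>\<^bsub>G\<^esub> d = d \<otimes>\<^bsub>G\<^esub> z)
      \<and> Ds (Suc i) \<subseteq> generate G ((\<lambda>(d, r). inv\<^bsub>G\<^esub> d \<otimes>\<^bsub>G\<^esub> (inv\<^bsub>G\<^esub> r \<otimes>\<^bsub>G\<^esub> d \<otimes>\<^bsub>G\<^esub> r)) ` (Ds (Suc i) \<times> Rs i))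
      \<and> (\<forall>x\<in>Gs i. x \<noteq> \<one>\<^bsub>G\<^esub> \<longrightarrow> (\<exists>d\<in>Ds (Suc i). \<exists>e\<in>Ds (Suc i).
          inv\<^bsub>G\<^esub> d \<otimes>\<^bsub>G\<^esub> (inv\<^bsub>G\<^esub> x \<otimes>\<^bsub>G\<^esub> d \<otimes>\<^bsub>G\<^esub> x) \<otimes>\<^bsub>G\<^esub> e \<noteq> e \<otimes>\<^bsub>G\<^esub> (inv\<^bsub>G\<^esub> d \<otimes>\<^bsub>G\<^esub> (inv\<^bsub>G\<^esub> x \<otimes>\<^bsub>G\<^esub> d \<otimes>\<^bsub>G\<^esub> x))))" for i
  proof -
    obtain \<theta> where "wreath_step G (M (Suc i)) (Gs i) (p (Suc i)) (Rs i) (Ds (Suc i)) (p i) \<theta>"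
      using wreath_step[OF P[of i]] by blast
    then interpret ws: wreath_step G "M (Suc i)" "Gs i" "p (Suc i)" "Rs i" "Ds (Suc i)" "p i" \<theta> .
    show ?thesis
      unfolding step(3)
      by (intro conjI ballI impI ws.D_subgroup ws.D_finite ws.D_normalised ws.card_derived
          ws.derived_central ws.D_generated ws.D_faithful)
  qed
  have comm: "comm_group (G\<lparr>carrier := Gs 0\<rparr>)"
    by (rule group.cyclic_imp_abelian_group[OF subgroup_imp_group[OF Gs_0(1)] Gs_0(2)])
  show ?thesis
    by (intro group_tower.intro group_tower_axioms.intro is_group Gs_0(1) fin_0 comm step Union)
      (use facts prime in \<open>(simp; fail) | blast\<close>)+
qed

theorem theorem2p7:
  fixes G :: "('a, 'b) monoid_scheme"
    and p :: "nat \<Rightarrow> nat"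
    and M :: "nat \<Rightarrow> ('m, 'c) monoid_scheme"
    and Gs Ds Rs :: "nat \<Rightarrow> 'a set"
  assumes "construction_limit G p M Gs Ds Rs"
  shows "periodic_group G \<and> locally_soluble G \<and> residually_finite G \<and>
         hereditarily_just_infinite G"
proof -
  interpret group_tower G Gs Ds Rs by (rule construction_limit_tower[OF assms])
  show ?thesis
    using periodic locally_soluble residually_finite hereditarily_just_infinite by blast
qed

end
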